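(* Let $A\in GL(n,\mathbb{C})$ and let $\Omega\subset\mathbb{C}^n$ be a domain that is positive-time flow invariant with respect to $A$ (that is, $e^{tA}(\Omega)\subset\Omega$ for every $t\ge 0$), with $0\in\Omega$. Suppose that $$E^c\subset\Omega\quad\text{and}\quad \operatorname{dist}(E^u\oplus E^c,\partial\Omega)>0.$$ Then $\Omega$ is a Runge domain.
   Context: A domain is a connected open set. For $A\in GL(n,\mathbb{C})$ let $\lambda_1,\dots,\lambda_m$ be its distinct eigenvalues and $m_j$ the size of the largest Jordan block of $A$ for $\lambda_j$. The unstable and center subspaces of $A$ are $$E^u=\bigoplus_{\operatorname{Re}\lambda_j>0}\ker (A-\lambda_jI)^{m_j},\quad E^c=\bigoplus_{\operatorname{Re}\lambda_j=0}\ker (A-\lambda_jI)^{m_j}.$$ $\|\cdot\|$ is the Euclidean norm. For $S\subset\mathbb{C}^n$, $\operatorname{dist}(S,\partial\Omega):=\inf\{\|x-y\|:x\in S,\ y\in\partial\Omega\}$ (with the infimum of the empty set equal to $+\infty$). A domain $\Omega\subset\mathbb{C}^n$ is Runge if every holomorphic function on $\Omega$ can be approximated, uniformly on compact subsets of $\Omega$, by holomorphic polynomials. *)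

theory Defs
  imports
    "HOL-Analysis.Analysis"
    "Jordan_Normal_Form.Jordan_Normal_Form"
begin

(* Both HOL-Analysis and Jordan_Normal_Form use the names vec, mat and the infix $;
   below they always mean the HOL-Analysis ones. *)
hide_const (open) Matrix.mat Matrix.vec
hide_type (open) Matrix.vec
no_notation Matrix.vec_index (infixl "$" 100)

definition domain_in_Cn :: "(complex ^ 'n) set \<Rightarrow> bool" where
  "domain_in_Cn \<Omega> \<longleftrightarrow> open \<Omega> \<and> connected \<Omega>"

(* On complex ^ 'n ^ 'n the class operations * and ^ are componentwise, so powers and the
   exponential have to be built from the matrix product **. *)
primrec matrix_power :: "complex ^ 'n ^ 'n \<Rightarrow> nat \<Rightarrow> complex ^ 'n ^ 'n" where
  "matrix_power M 0 = mat 1"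
| "matrix_power M (Suc k) = M ** matrix_power M k"

definition matrix_exp :: "complex ^ 'n ^ 'n \<Rightarrow> complex ^ 'n ^ 'n" where
  "matrix_exp M = (\<Sum>k. (1 / fact k) *\<^sub>R matrix_power M k)"

definition positive_time_flow_invariant ::
    "complex ^ 'n ^ 'n \<Rightarrow> (complex ^ 'n) set \<Rightarrow> bool" where
  "positive_time_flow_invariant A \<Omega> \<longleftrightarrow>
     (\<forall>t\<ge>0. (\<lambda>x. matrix_exp (t *\<^sub>R A) *v x) ` \<Omega> \<subseteq> \<Omega>)"

definition eigenvalues :: "complex ^ 'n ^ 'n \<Rightarrow> complex set" where
  "eigenvalues A = {l. \<exists>v. v \<noteq> 0 \<and> A *v v = l *s v}"

(* The enumeration from_nat_into UNIV is a bijection from {..<CARD('n)} to the finite index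
   type; another enumeration would give a similar matrix. *)
definition to_jnf_mat :: "complex ^ 'n ^ 'n \<Rightarrow> complex Matrix.mat" where
  "to_jnf_mat A = Matrix.mat CARD('n) CARD('n)
     (\<lambda>(i, j). A $ from_nat_into UNIV i $ from_nat_into UNIV j)"

(* A list as in jordan_nf consists of the pairs (block size, eigenvalue); it is determined
   by the matrix up to reordering. *)
definition largest_jordan_block :: "complex ^ 'n ^ 'n \<Rightarrow> complex \<Rightarrow> nat" where
  "largest_jordan_block A l =
     (GREATEST m. \<exists>n_as. jordan_nf (to_jnf_mat A) n_as \<and> (m, l) \<in> set n_as)"

definition generalized_eigenspace :: "complex ^ 'n ^ 'n \<Rightarrow> complex \<Rightarrow> (complex ^ 'n) set" where
  "generalized_eigenspace A l =
     {x. matrix_power (A - mat l) (largest_jordan_block A l) *v x = 0}"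

(* Only used for finite I. The sums in question are automatically direct, since generalized
   eigenspaces for distinct eigenvalues are linearly independent. *)
definition subspace_sum :: "'i set \<Rightarrow> ('i \<Rightarrow> 'v set) \<Rightarrow> 'v::comm_monoid_add set" where
  "subspace_sum I V = {(\<Sum>i\<in>I. v i) | v. \<forall>i\<in>I. v i \<in> V i}"

definition unstable_subspace :: "complex ^ 'n ^ 'n \<Rightarrow> (complex ^ 'n) set" where
  "unstable_subspace A =
     subspace_sum {l \<in> eigenvalues A. Re l > 0} (generalized_eigenspace A)"

definition center_subspace :: "complex ^ 'n ^ 'n \<Rightarrow> (complex ^ 'n) set" where
  "center_subspace A =
     subspace_sum {l \<in> eigenvalues A. Re l = 0} (generalized_eigenspace A)"

definition unstable_center_subspace :: "complex ^ 'n ^ 'n \<Rightarrow> (complex ^ 'n) set" where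
  "unstable_center_subspace A = {x + y | x y. x \<in> unstable_subspace A \<and> y \<in> center_subspace A}"

(* The library's setdist and infdist are real-valued and return 0 on empty sets; over ereal
   the infimum of the empty set is infinity. *)
definition dist_to_boundary :: "(complex ^ 'n) set \<Rightarrow> (complex ^ 'n) set \<Rightarrow> ereal" where
  "dist_to_boundary S \<Omega> = (INF (x, y)\<in>S \<times> frontier \<Omega>. ereal (norm (x - y)))"

(* Complex Frechet differentiability: the real derivative exists at every point and is
   complex linear. Meant for open sets. *)
definition holomorphic_Cn :: "(complex ^ 'n \<Rightarrow> complex) \<Rightarrow> (complex ^ 'n) set \<Rightarrow> bool" where
  "holomorphic_Cn f \<Omega> \<longleftrightarrow>
     (\<forall>z\<in>\<Omega>. \<exists>f'. (f has_derivative f') (at z) \<and> (\<forall>c v. f' (c *s v) = c * f' v))"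

definition holomorphic_polynomial :: "(complex ^ 'n \<Rightarrow> complex) \<Rightarrow> bool" where
  "holomorphic_polynomial p \<longleftrightarrow>
     (\<exists>(S :: ('n \<Rightarrow> nat) set) c. finite S \<and>
        p = (\<lambda>z. \<Sum>\<alpha>\<in>S. c \<alpha> * (\<Prod>i\<in>UNIV. (z $ i) ^ \<alpha> i)))"

definition runge_domain :: "(complex ^ 'n) set \<Rightarrow> bool" where
  "runge_domain \<Omega> \<longleftrightarrow> domain_in_Cn \<Omega> \<and>
     (\<forall>f. holomorphic_Cn f \<Omega> \<longrightarrow>
        (\<forall>K \<epsilon>. compact K \<and> K \<subseteq> \<Omega> \<and> \<epsilon> > 0 \<longrightarrow>
           (\<exists>p. holomorphic_polynomial p \<and> (\<forall>z\<in>K. norm (f z - p z) < \<epsilon>))))"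

end

theory Submission
  imports
    Defs
    "Jordan_Normal_Form.Jordan_Normal_Form_Existence"
    "Jordan_Normal_Form.Jordan_Normal_Form_Uniqueness"
    "Jordan_Normal_Form.Spectral_Radius"
    "HOL-Complex_Analysis.Complex_Analysis"
    "HOL-Real_Asymp.Real_Asymp"
begin

text \<open>
  Let \<open>f\<close> be holomorphic on \<open>\<Omega>\<close> and \<open>K \<subseteq> \<Omega>\<close> compact, and call a function approximable if it is a
  uniform limit on \<open>K\<close> of polynomials. Consider the family \<open>f \<circ> exp (t A)\<close>, which is defined on \<open>K\<close>
  for all \<open>t \<ge> 0\<close> by flow invariance and depends holomorphically on \<open>t\<close> in a complex neighbourhood of
  each interval \<open>[0, T]\<close>. The approximable functions form a closed subspace, and a holomorphic family that
  lies in a closed subspace for parameters with an accumulation point lies in it throughout a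
  connected parameter domain (\<open>poly_approx_continuation\<close>). Thus it suffices to approximate
  \<open>f \<circ> exp (t A)\<close> for large \<open>t\<close>, and the case \<open>t = 0\<close> follows.

  Since the stable part of every vector decays, \<open>exp (t A)\<close> moves \<open>K\<close> for large \<open>t\<close> into any prescribed
  tube around the sum of the unstable and center subspaces
  (\<open>flow_attracted_to_unstable_center\<close>). The distance hypothesis provides such a tube inside \<open>\<Omega>\<close>
  (\<open>tube_around_subspace\<close>). The tube is star-shaped about \<open>0\<close>, so the same continuation
  argument, applied to \<open>f (s w)\<close> with \<open>s\<close> from \<open>0\<close> to \<open>1\<close>, reduces the claim to small \<open>s\<close>
  (\<open>poly_approx_starlike\<close>), that is, to approximation on a small polydisc
  (\<open>poly_approx_polydisc\<close>). On a polydisc one expands in one variable at a time; the Taylor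
  coefficients are approximable because they are limits of difference quotients
  (\<open>poly_approx_coeff\<close>), so no integral formula in several variables is needed.

  The decay of the stable part rests on the decomposition of the space into generalized
  eigenspaces, which is read off from a Jordan normal form (\<open>generalized_eigenspaces_span\<close>).
\<close>

(* Of the competing meanings of vec, mat and the infix $, those for finite Cartesian products are kept. *)
hide_const (open) Matrix.mat Matrix.vec
hide_type (open) Matrix.vec
no_notation Matrix.vec_index (infixl "$" 100)
no_notation fps_nth (infixl "$" 75)

section \<open>Holomorphic polynomials and their uniform limits\<close>

text \<open>Membership of (the restriction to \<open>K\<close> of) \<open>g\<close> in the uniform closure on \<open>K\<close> of the
  holomorphic polynomials. The function \<open>g\<close> is total, but only its values on \<open>K\<close> matter.\<close>

definition poly_approx :: "(complex ^ 'n) set \<Rightarrow> (complex ^ 'n \<Rightarrow> complex) \<Rightarrow> bool" where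
  "poly_approx K g \<longleftrightarrow>
     (\<forall>\<epsilon>>0. \<exists>p. holomorphic_polynomial p \<and> (\<forall>z\<in>K. norm (g z - p z) < \<epsilon>))"

lemma holomorphic_polynomial_const: "holomorphic_polynomial (\<lambda>z. c :: complex)"
  unfolding holomorphic_polynomial_def
  by (intro exI[of _ "{\<lambda>_. 0}"] exI[of _ "\<lambda>_. c"]) auto

lemma holomorphic_polynomial_coord: "holomorphic_polynomial (\<lambda>z :: complex ^ 'n. z $ i)"
proof -
  have "(\<Prod>j\<in>UNIV. (z $ j) ^ (if j = i then 1 else 0)) = z $ i" for z :: "complex ^ 'n"
    by (subst prod.remove[of _ i]) auto
  then show ?thesis
    unfolding holomorphic_polynomial_def
    by (intro exI[of _ "{\<lambda>j. if j = i then 1 else 0}"] exI[of _ "\<lambda>_. 1"]) simp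
qed

lemma holomorphic_polynomial_add:
  assumes "holomorphic_polynomial p" "holomorphic_polynomial q"
  shows "holomorphic_polynomial (\<lambda>z. p z + q z)"
proof -
  obtain S c where p: "finite S" "p = (\<lambda>z. \<Sum>\<alpha>\<in>S. c \<alpha> * (\<Prod>i\<in>UNIV. (z $ i) ^ \<alpha> i))"
    using assms(1) unfolding holomorphic_polynomial_def by blast
  obtain T d where q: "finite T" "q = (\<lambda>z. \<Sum>\<alpha>\<in>T. d \<alpha> * (\<Prod>i\<in>UNIV. (z $ i) ^ \<alpha> i))"
    using assms(2) unfolding holomorphic_polynomial_def by blast
  let ?c = "\<lambda>\<alpha>. (if \<alpha> \<in> S then c \<alpha> else 0)" and ?d = "\<lambda>\<alpha>. (if \<alpha> \<in> T then d \<alpha> else 0)"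
  have p': "p z = (\<Sum>\<alpha>\<in>S \<union> T. ?c \<alpha> * (\<Prod>i\<in>UNIV. (z $ i) ^ \<alpha> i))" for z
    unfolding p(2) using p q by (intro sum.mono_neutral_cong_left) auto
  have q': "q z = (\<Sum>\<alpha>\<in>S \<union> T. ?d \<alpha> * (\<Prod>i\<in>UNIV. (z $ i) ^ \<alpha> i))" for z
    unfolding q(2) using p q by (intro sum.mono_neutral_cong_left) auto
  have "(\<lambda>z. p z + q z) = (\<lambda>z. \<Sum>\<alpha>\<in>S \<union> T. (?c \<alpha> + ?d \<alpha>) * (\<Prod>i\<in>UNIV. (z $ i) ^ \<alpha> i))"
    by (rule ext) (simp only: p' q' sum.distrib distrib_right)
  then show ?thesis
    unfolding holomorphic_polynomial_def using p(1) q(1)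
    by (intro exI[of _ "S \<union> T"] exI[of _ "\<lambda>\<alpha>. ?c \<alpha> + ?d \<alpha>"] conjI) auto
qed

lemma holomorphic_polynomial_sum:
  assumes "finite I" "\<And>i. i \<in> I \<Longrightarrow> holomorphic_polynomial (p i)"
  shows "holomorphic_polynomial (\<lambda>z. \<Sum>i\<in>I. p i z)"
  using assms
  by (induction I) (auto intro: holomorphic_polynomial_const holomorphic_polynomial_add)

lemma holomorphic_polynomial_mult:
  assumes "holomorphic_polynomial p" "holomorphic_polynomial q"
  shows "holomorphic_polynomial (\<lambda>z. p z * q z)"
proof -
  obtain S c where p: "finite S" "p = (\<lambda>z. \<Sum>\<alpha>\<in>S. c \<alpha> * (\<Prod>i\<in>UNIV. (z $ i) ^ \<alpha> i))"
    using assms(1) unfolding holomorphic_polynomial_def by blast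
  obtain T d where q: "finite T" "q = (\<lambda>z. \<Sum>\<alpha>\<in>T. d \<alpha> * (\<Prod>i\<in>UNIV. (z $ i) ^ \<alpha> i))"
    using assms(2) unfolding holomorphic_polynomial_def by blast
  have mono: "holomorphic_polynomial (\<lambda>z. (c \<alpha> * d \<beta>) * (\<Prod>i\<in>UNIV. (z $ i) ^ (\<alpha> i + \<beta> i)))" for \<alpha> \<beta>
    unfolding holomorphic_polynomial_def
    by (intro exI[of _ "{\<lambda>i. \<alpha> i + \<beta> i}"] exI[of _ "\<lambda>_. c \<alpha> * d \<beta>"]) simp
  have "(\<lambda>z. p z * q z) =
      (\<lambda>z. \<Sum>\<alpha>\<in>S. \<Sum>\<beta>\<in>T. (c \<alpha> * d \<beta>) * (\<Prod>i\<in>UNIV. (z $ i) ^ (\<alpha> i + \<beta> i)))"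
    unfolding p(2) q(2) by (auto simp: sum_product power_add prod.distrib mult_ac)
  then show ?thesis
    using p(1) q(1) by (auto intro!: holomorphic_polynomial_sum mono)
qed

lemma holomorphic_polynomial_prod:
  assumes "finite I" "\<And>i. i \<in> I \<Longrightarrow> holomorphic_polynomial (p i)"
  shows "holomorphic_polynomial (\<lambda>z. \<Prod>i\<in>I. p i z)"
  using assms
  by (induction I) (auto intro: holomorphic_polynomial_const holomorphic_polynomial_mult)

lemma holomorphic_polynomial_power:
  assumes "holomorphic_polynomial p"
  shows "holomorphic_polynomial (\<lambda>z. p z ^ k)"
  using assms
  by (induction k) (auto intro: holomorphic_polynomial_const holomorphic_polynomial_mult)

lemma holomorphic_polynomial_matrix:
  assumes "holomorphic_polynomial p"
  shows "holomorphic_polynomial (\<lambda>z. p (B *v z))"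
proof -
  obtain S c where p: "finite S" "p = (\<lambda>z. \<Sum>\<alpha>\<in>S. c \<alpha> * (\<Prod>i\<in>UNIV. (z $ i) ^ \<alpha> i))"
    using assms unfolding holomorphic_polynomial_def by blast
  have "holomorphic_polynomial (\<lambda>z. (B *v z) $ i)" for i
    unfolding matrix_vector_mult_def
    by (auto intro!: holomorphic_polynomial_sum holomorphic_polynomial_mult
        holomorphic_polynomial_const holomorphic_polynomial_coord)
  then show ?thesis unfolding p(2)
    by (intro holomorphic_polynomial_sum holomorphic_polynomial_mult holomorphic_polynomial_prod
        holomorphic_polynomial_power p(1) holomorphic_polynomial_const) auto
qed

lemma poly_approx_if_polynomial: "holomorphic_polynomial p \<Longrightarrow> poly_approx K p"
  unfolding poly_approx_def by auto

lemma poly_approx_add: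
  assumes "poly_approx K f" "poly_approx K g"
  shows "poly_approx K (\<lambda>z. f z + g z)"
  unfolding poly_approx_def
proof (intro allI impI)
  fix \<epsilon> :: real assume "\<epsilon> > 0"
  then have e: "\<epsilon> / 2 > 0" by simp
  obtain p where p: "holomorphic_polynomial p" "\<And>z. z \<in> K \<Longrightarrow> norm (f z - p z) < \<epsilon> / 2"
    using assms(1) e unfolding poly_approx_def by blast
  obtain q where q: "holomorphic_polynomial q" "\<And>z. z \<in> K \<Longrightarrow> norm (g z - q z) < \<epsilon> / 2"
    using assms(2) e unfolding poly_approx_def by blast
  have "norm ((f z + g z) - (p z + q z)) < \<epsilon>" if "z \<in> K" for z
    using norm_diff_triangle_ineq[of "f z" "g z" "p z" "q z"] p(2)[OF that] q(2)[OF that] by linarith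
  then show "\<exists>p. holomorphic_polynomial p \<and> (\<forall>z\<in>K. norm (f z + g z - p z) < \<epsilon>)"
    using holomorphic_polynomial_add[OF p(1) q(1)] by blast
qed

lemma poly_approx_closed:
  assumes "\<And>\<epsilon>. \<epsilon> > 0 \<Longrightarrow> \<exists>h. poly_approx K h \<and> (\<forall>z\<in>K. norm (g z - h z) \<le> \<epsilon>)"
  shows "poly_approx K g"
  unfolding poly_approx_def
proof (intro allI impI)
  fix \<epsilon> :: real assume "\<epsilon> > 0"
  then have e: "\<epsilon> / 2 > 0" by simp
  obtain h where h: "poly_approx K h" "\<And>z. z \<in> K \<Longrightarrow> norm (g z - h z) \<le> \<epsilon> / 2"
    using assms[OF e] by blast
  obtain p where p: "holomorphic_polynomial p" "\<And>z. z \<in> K \<Longrightarrow> norm (h z - p z) < \<epsilon> / 2"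
    using h(1) e unfolding poly_approx_def by blast
  have "norm (g z - p z) < \<epsilon>" if "z \<in> K" for z
    using norm_triangle_ineq[of "g z - h z" "h z - p z"] h(2)[OF that] p(2)[OF that] by simp
  then show "\<exists>p. holomorphic_polynomial p \<and> (\<forall>z\<in>K. norm (g z - p z) < \<epsilon>)" using p(1) by blast
qed

lemma poly_approx_cong: "(\<And>z. z \<in> K \<Longrightarrow> f z = g z) \<Longrightarrow> poly_approx K f \<longleftrightarrow> poly_approx K g"
  unfolding poly_approx_def by (metis (no_types, lifting))

lemma holomorphic_polynomial_bounded:
  assumes "holomorphic_polynomial p" "compact K"
  shows "\<exists>B>0. \<forall>z\<in>K. norm (p z) \<le> B"
proof -
  have "continuous_on K p"
    using assms(1) unfolding holomorphic_polynomial_def by (auto intro!: continuous_intros)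
  then have "bounded (p ` K)"
    using assms(2) compact_continuous_image compact_imp_bounded by blast
  then show ?thesis unfolding bounded_pos by auto
qed

lemma poly_approx_bounded:
  assumes "poly_approx K g" "compact K"
  shows "\<exists>B>0. \<forall>z\<in>K. norm (g z) \<le> B"
proof -
  obtain p where p: "holomorphic_polynomial p" "\<And>z. z \<in> K \<Longrightarrow> norm (g z - p z) < 1"
    using assms(1)[unfolded poly_approx_def, rule_format, of 1] by auto
  obtain B where B: "B > 0" "\<And>z. z \<in> K \<Longrightarrow> norm (p z) \<le> B"
    using holomorphic_polynomial_bounded[OF p(1) assms(2)] by blast
  have "norm (g z) \<le> B + 1" if "z \<in> K" for z
    using norm_triangle_ineq[of "g z - p z" "p z"] p(2)[OF that] B(2)[OF that] by simp
  then show ?thesis using B(1) by (intro exI[of _ "B + 1"]) auto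
qed

lemma poly_approx_mult:
  assumes K: "compact K" and f: "poly_approx K f" and g: "poly_approx K g"
  shows "poly_approx K (\<lambda>z. f z * g z)"
  unfolding poly_approx_def
proof (intro allI impI)
  fix \<epsilon> :: real assume e: "\<epsilon> > 0"
  obtain B where B: "B > 0" "\<And>z. z \<in> K \<Longrightarrow> norm (g z) \<le> B"
    using poly_approx_bounded[OF g K] by blast
  have "\<epsilon> / (2 * B) > 0" using e B by simp
  then obtain p where p: "holomorphic_polynomial p"
      "\<And>z. z \<in> K \<Longrightarrow> norm (f z - p z) < \<epsilon> / (2 * B)"
    using f unfolding poly_approx_def by blast
  obtain C where C: "C > 0" "\<And>z. z \<in> K \<Longrightarrow> norm (p z) \<le> C"
    using holomorphic_polynomial_bounded[OF p(1) K] by blast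
  have "\<epsilon> / (2 * C) > 0" using e C by simp
  then obtain q where q: "holomorphic_polynomial q"
      "\<And>z. z \<in> K \<Longrightarrow> norm (g z - q z) < \<epsilon> / (2 * C)"
    using g unfolding poly_approx_def by blast
  have "norm (f z * g z - p z * q z) < \<epsilon>" if z: "z \<in> K" for z
  proof -
    have "norm (f z * g z - p z * q z) = norm ((f z - p z) * g z + p z * (g z - q z))"
      by (simp add: algebra_simps)
    also have "\<dots> \<le> norm (f z - p z) * norm (g z) + norm (p z) * norm (g z - q z)"
      by (metis norm_mult norm_triangle_ineq)
    also have "norm (f z - p z) * norm (g z) \<le> norm (f z - p z) * B"
      using B z by (intro mult_left_mono) auto
    also have "norm (f z - p z) * B < \<epsilon> / (2 * B) * B"
      using p(2)[OF z] B(1) by (intro mult_strict_right_mono) auto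
    also have "norm (p z) * norm (g z - q z) \<le> C * (\<epsilon> / (2 * C))"
      using C z q(2)[OF z] by (intro mult_mono) auto
    finally show ?thesis using B C by simp
  qed
  then show "\<exists>p. holomorphic_polynomial p \<and> (\<forall>z\<in>K. norm (f z * g z - p z) < \<epsilon>)"
    using holomorphic_polynomial_mult[OF p(1) q(1)] by blast
qed

lemma poly_approx_const: "poly_approx K (\<lambda>z. c)"
  by (rule poly_approx_if_polynomial[OF holomorphic_polynomial_const])

lemma poly_approx_sum:
  assumes "finite I" "\<And>i. i \<in> I \<Longrightarrow> poly_approx K (f i)"
  shows "poly_approx K (\<lambda>z. \<Sum>i\<in>I. f i z)"
  using assms by (induction I) (auto intro: poly_approx_const poly_approx_add)

lemma poly_approx_power:
  assumes "compact K" "poly_approx K f"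
  shows "poly_approx K (\<lambda>z. f z ^ k)"
  using assms by (induction k) (auto intro: poly_approx_const poly_approx_mult)

lemma poly_approx_matrix:
  assumes "poly_approx L g" "\<And>z. z \<in> K \<Longrightarrow> B *v z \<in> L"
  shows "poly_approx K (\<lambda>z. g (B *v z))"
  unfolding poly_approx_def
proof (intro allI impI)
  fix \<epsilon> :: real assume "\<epsilon> > 0"
  then obtain p where "holomorphic_polynomial p" "\<forall>z\<in>L. norm (g z - p z) < \<epsilon>"
    using assms(1) unfolding poly_approx_def by blast
  then show "\<exists>p. holomorphic_polynomial p \<and> (\<forall>z\<in>K. norm (g (B *v z) - p z) < \<epsilon>)"
    using assms(2) by (intro exI[of _ "\<lambda>z. p (B *v z)"]) (auto intro: holomorphic_polynomial_matrix)
qed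


section \<open>Holomorphic families of approximable functions\<close>

lemma poly_approx_power_series:
  assumes K: "compact K" and a: "\<And>k. poly_approx K (a k)"
    and bound: "\<And>k z. z \<in> K \<Longrightarrow> norm (a k z) \<le> M / r ^ k"
    and g: "poly_approx K g" "\<And>z. z \<in> K \<Longrightarrow> norm (g z) \<le> \<rho>" and \<rho>: "0 \<le> \<rho>" "\<rho> < r"
  shows "poly_approx K (\<lambda>z. \<Sum>k. a k z * g z ^ k)"
proof (rule poly_approx_closed)
  fix \<epsilon> :: real assume e: "\<epsilon> > 0"
  have "norm (a k z * g z ^ k) \<le> M * (\<rho> / r) ^ k" if z: "z \<in> K" for k z
  proof -
    have "norm (a k z * g z ^ k) \<le> M / r ^ k * \<rho> ^ k"
      unfolding norm_mult norm_power
      using bound[OF z, of k] g(2)[OF z]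
      by (intro mult_mono power_mono) (auto intro: order_trans[OF norm_ge_zero])
    then show ?thesis by (simp add: power_divide)
  qed
  moreover have "summable (\<lambda>k. M * (\<rho> / r) ^ k)"
    using \<rho> by (intro summable_mult summable_geometric) auto
  ultimately have "uniform_limit K (\<lambda>n z. \<Sum>k<n. a k z * g z ^ k) (\<lambda>z. \<Sum>k. a k z * g z ^ k) sequentially"
    by (rule Weierstrass_m_test)
  from uniform_limitD[OF this e]
  obtain n where "\<forall>z\<in>K. dist (\<Sum>k<n. a k z * g z ^ k) (\<Sum>k. a k z * g z ^ k) < \<epsilon>"
    by (auto simp: eventually_sequentially)
  then show "\<exists>h. poly_approx K h \<and> (\<forall>z\<in>K. norm ((\<Sum>k. a k z * g z ^ k) - h z) \<le> \<epsilon>)"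
    by (intro exI[of _ "\<lambda>z. \<Sum>k<n. a k z * g z ^ k"] conjI poly_approx_sum poly_approx_mult
        poly_approx_power a g(1) K) (auto simp: dist_norm norm_minus_commute less_imp_le)
qed

text \<open>If the sums \<open>\<Sum> a\<^sub>k h^k\<close> are approximable for arbitrarily small \<open>h \<noteq> 0\<close>, then so is every coefficient:
  once this is known for the \<open>a\<^sub>j\<close> with \<open>j < k\<close>, subtract their terms and divide by \<open>h^k\<close>. The result
  is approximable, and by the bound on the coefficients it differs from \<open>a\<^sub>k\<close> by \<open>O(h)\<close> uniformly
  on \<open>K\<close>.\<close>

lemma poly_approx_coeff:
  assumes K: "compact K" and r: "r > 0"
    and bound: "\<And>k z. z \<in> K \<Longrightarrow> norm (a k z) \<le> M / r ^ k"
    and lim: "0 islimpt {h. poly_approx K (\<lambda>z. \<Sum>k. a k z * h ^ k)}"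
  shows "poly_approx K (a k)"
proof (induction k rule: less_induct)
  case (less k)
  show ?case
  proof (rule poly_approx_closed)
    fix \<epsilon> :: real assume e: "\<epsilon> > 0"
    \<comment> \<open>The constant \<open>C\<close> bounds the geometric tail, whose ratio \<open>norm h / r\<close> is at most one half.\<close>
    define C where "C = 2 * \<bar>M\<bar> / r ^ Suc k"
    have C: "C \<ge> 0" using r by (simp add: C_def)
    define \<delta> where "\<delta> = min (r / 2) (\<epsilon> / (C + 1))"
    have "\<delta> > 0" using r e C by (auto simp: \<delta>_def)
    then obtain h where h: "h \<noteq> 0" "norm h < \<delta>"
      and app: "poly_approx K (\<lambda>z. \<Sum>k. a k z * h ^ k)"
      using lim unfolding islimpt_approachable by (auto simp: dist_norm)
    have hr: "norm h < r / 2" and he: "norm h < \<epsilon> / (C + 1)" using h by (auto simp: \<delta>_def)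
    let ?q = "\<lambda>z. inverse (h ^ k) * ((\<Sum>j. a j z * h ^ j) + (-1) * (\<Sum>j<k. a j z * h ^ j))"
    have "poly_approx K ?q"
      by (intro poly_approx_mult poly_approx_add poly_approx_sum app K poly_approx_const less) auto
    moreover have "norm (a k z - ?q z) \<le> \<epsilon>" if z: "z \<in> K" for z
    proof -
      have M: "\<bar>M\<bar> = M" using order_trans[OF norm_ge_zero bound[OF z, of 0]] by simp
      have nb: "norm (a (j + k) z * h ^ (j + k)) \<le> M * (norm h / r) ^ (j + k)" for j k
        using mult_right_mono[OF bound[OF z, of "j + k"], of "norm h ^ (j + k)"]
        by (simp add: norm_mult norm_power power_divide)
      have half: "norm h / r \<le> 1 / 2" "0 \<le> norm h / r" using hr r by (auto simp: field_simps)
      have geo: "summable (\<lambda>j. M * (norm h / r) ^ j)"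
        using half r by (intro summable_mult summable_geometric) auto
      have "summable (\<lambda>j. norm (a j z * h ^ j))"
        by (rule summable_comparison_test'[OF geo, of 0]) (use nb[of _ 0] in auto)
      then have sm: "summable (\<lambda>j. a j z * h ^ j)" by (rule summable_norm_cancel)
      have tail: "(\<Sum>j. a j z * h ^ j) - (\<Sum>j<k. a j z * h ^ j) - a k z * h ^ k
          = (\<Sum>j. a (j + Suc k) z * h ^ (j + Suc k))"
        using suminf_split_initial_segment[OF sm, of "Suc k"] by simp
      have "norm (\<Sum>j. a (j + Suc k) z * h ^ (j + Suc k)) \<le> (\<Sum>j. M * (norm h / r) ^ (j + Suc k))"
        using geo by (intro norm_suminf_le nb) (rule summable_ignore_initial_segment)
      also have "\<dots> = (\<Sum>j. (M * (norm h / r) ^ Suc k) * (norm h / r) ^ j)"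
        by (simp add: power_add mult_ac)
      also have "\<dots> = M * (norm h / r) ^ Suc k * (1 / (1 - norm h / r))"
        using half by (subst suminf_mult) (use hr r in \<open>auto simp: suminf_geometric divide_less_eq\<close>)
      also have "\<dots> \<le> M * (norm h / r) ^ Suc k * 2"
        using half M r
        by (intro mult_left_mono mult_nonneg_nonneg zero_le_power) (simp_all add: divide_le_eq)
      also have "\<dots> = C * norm h * norm h ^ k" using M by (simp add: C_def power_divide)
      finally have t: "norm (\<Sum>j. a (j + Suc k) z * h ^ (j + Suc k)) \<le> C * norm h * norm h ^ k" .
      have "?q z - a k z = inverse (h ^ k) *
          ((\<Sum>j. a j z * h ^ j) - (\<Sum>j<k. a j z * h ^ j) - a k z * h ^ k)"
        using h(1) by (simp add: algebra_simps)
      then have "norm (a k z - ?q z) = norm (\<Sum>j. a (j + Suc k) z * h ^ (j + Suc k)) / norm h ^ k"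
        unfolding tail by (metis (no_types, lifting) norm_minus_commute norm_mult norm_inverse norm_power divide_inverse mult.commute)
      also have "\<dots> \<le> C * norm h" using t h(1) by (simp add: divide_le_eq)
      also have "\<dots> \<le> (C + 1) * (\<epsilon> / (C + 1))" using he C by (intro mult_mono) auto
      also have "\<dots> = \<epsilon>" using C by simp
      finally show ?thesis .
    qed
    ultimately show "\<exists>h. poly_approx K h \<and> (\<forall>z\<in>K. norm (a k z - h z) \<le> \<epsilon>)" by blast
  qed
qed

text \<open>If \<open>F s\<close> is approximable for parameters \<open>s\<close> accumulating at the centre of a disc on which \<open>F\<close>
  is holomorphic in the parameter and bounded, then the parameter may be any point of the disc, or
  even an approximable function \<open>g\<close> of \<open>z\<close> with values in a smaller concentric disc. Constant \<open>g\<close> is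
  what analytic continuation needs; \<open>g\<close> a coordinate is used to expand a function of several
  variables in one variable at a time.\<close>

lemma poly_approx_disc:
  fixes F :: "complex \<Rightarrow> complex ^ 'n \<Rightarrow> complex"
  assumes K: "compact K" and r: "r > 0"
    and hol: "\<And>z. z \<in> K \<Longrightarrow> (\<lambda>s. F s z) holomorphic_on cball t r"
    and bound: "\<And>s z. s \<in> cball t r \<Longrightarrow> z \<in> K \<Longrightarrow> norm (F s z) \<le> M"
    and lim: "t islimpt {s. poly_approx K (F s)}"
    and g: "poly_approx K g" "\<And>z. z \<in> K \<Longrightarrow> norm (g z - t) \<le> \<rho>" and \<rho>: "0 \<le> \<rho>" "\<rho> < r"
  shows "poly_approx K (\<lambda>z. F (g z) z)"
proof -
  define a where "a k z = (deriv ^^ k) (\<lambda>s. F s z) t / fact k" for k z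
  have hol': "(\<lambda>s. F s z) holomorphic_on ball t r" if "z \<in> K" for z
    using hol[OF that] by (rule holomorphic_on_subset) auto
  have bd: "norm (a k z) \<le> M / r ^ k" if z: "z \<in> K" for k z
  proof -
    have "norm ((deriv ^^ k) (\<lambda>s. F s z) t) \<le> fact k * M / r ^ k"
      using hol'[OF z] holomorphic_on_imp_continuous_on[OF hol[OF z]] r
      by (rule Cauchy_inequality) (use bound z in \<open>auto simp: dist_norm\<close>)
    then show ?thesis by (simp add: a_def norm_divide divide_le_eq mult.commute)
  qed
  have ser: "(\<Sum>k. a k z * (s - t) ^ k) = F s z" if "z \<in> K" "norm (s - t) < r" for s z
    using holomorphic_power_series[OF hol'[OF that(1)], of s] that(2)
    by (auto simp: a_def sums_iff dist_norm norm_minus_commute)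
  have "0 islimpt {h. poly_approx K (\<lambda>z. \<Sum>k. a k z * h ^ k)}"
    unfolding islimpt_approachable
  proof (intro allI impI)
    fix e :: real assume "e > 0"
    then have "min e r > 0" using r by simp
    then obtain s where s: "poly_approx K (F s)" "s \<noteq> t" "dist s t < min e r"
      using lim unfolding islimpt_approachable by blast
    have "poly_approx K (\<lambda>z. \<Sum>k. a k z * (s - t) ^ k)"
      using s(1) by (rule poly_approx_cong[THEN iffD1, rotated])
        (use s ser in \<open>auto simp: dist_norm\<close>)
    then show "\<exists>h\<in>{h. poly_approx K (\<lambda>z. \<Sum>k. a k z * h ^ k)}. h \<noteq> 0 \<and> dist h 0 < e"
      using s by (intro bexI[of _ "s - t"]) (auto simp: dist_norm)
  qed
  then have "poly_approx K (a k)" for k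
    using poly_approx_coeff[OF K r, of a M] bd by blast
  moreover have "poly_approx K (\<lambda>z. g z + (- t))"
    by (intro poly_approx_add g poly_approx_const)
  ultimately have "poly_approx K (\<lambda>z. \<Sum>k. a k z * (g z + (- t)) ^ k)"
    by (intro poly_approx_power_series[OF K _ bd _ _ \<rho>]) (use g in auto)
  then show ?thesis
    by (rule poly_approx_cong[THEN iffD1, rotated]) (use ser g \<rho> in force)
qed

text \<open>An identity theorem for the closed subspace of approximable functions: the
  accumulation points of the parameters \<open>s\<close> with \<open>F s\<close> approximable form a closed set, whose
  intersection with \<open>S\<close> is open by the preceding lemma.\<close>

lemma poly_approx_continuation:
  fixes F :: "complex \<Rightarrow> complex ^ 'n \<Rightarrow> complex"
  assumes K: "compact K" and S: "open S" "connected S"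
    and hol: "\<And>z. z \<in> K \<Longrightarrow> (\<lambda>s. F s z) holomorphic_on S"
    and bound: "\<And>s z. s \<in> S \<Longrightarrow> z \<in> K \<Longrightarrow> norm (F s z) \<le> M"
    and t0: "t0 \<in> S" "t0 islimpt {s. poly_approx K (F s)}"
    and t: "t \<in> S"
  shows "poly_approx K (F t)"
proof -
  define G where "G = {t. t islimpt {s. poly_approx K (F s)}}"
  have loc: "\<exists>r>0. ball t r \<subseteq> S \<and> (\<forall>s\<in>ball t r. poly_approx K (F s))"
    if t: "t \<in> S" "t \<in> G" for t
  proof -
    obtain r where r: "r > 0" "cball t r \<subseteq> S"
      using S(1) t(1) open_contains_cball by blast
    have "poly_approx K (F s)" if "s \<in> ball t r" for s
    proof (rule poly_approx_disc[OF K r(1), where g = "\<lambda>_. s" and \<rho> = "norm (s - t)" and M = M])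
      show "(\<lambda>s. F s z) holomorphic_on cball t r" if "z \<in> K" for z
        using hol[OF that] r(2) by (rule holomorphic_on_subset)
    qed (use that t r bound[OF subsetD[OF r(2)]] in \<open>auto simp: G_def poly_approx_const dist_norm norm_minus_commute\<close>)
    then show ?thesis using r by (meson ball_subset_cball order_trans)
  qed
  have "closedin (top_of_set S) (S \<inter> G)"
    by (auto simp: closedin_closed G_def intro!: exI[of _ "{t. t islimpt {s. poly_approx K (F s)}}"]
        closed_limpts)
  moreover have "openin (top_of_set S) (S \<inter> G)"
  proof (rule openin_open_eq[OF S(1), THEN iffD2], safe)
    show "open (S \<inter> G)"
      unfolding open_contains_ball
    proof
      fix t assume "t \<in> S \<inter> G"
      then obtain r where r: "r > 0" "ball t r \<subseteq> S" "\<forall>s\<in>ball t r. poly_approx K (F s)"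
        using loc by blast
      have "s \<in> G" if "s \<in> ball t r" for s
      proof -
        have "s islimpt ball t r" using that interior_limit_point[of s "ball t r"] by simp
        then show ?thesis unfolding G_def using r(3) by (auto intro: islimpt_subset)
      qed
      then show "\<exists>e>0. ball t e \<subseteq> S \<inter> G" using r by blast
    qed
  qed
  moreover have "S \<inter> G \<noteq> {}" using t0 by (auto simp: G_def)
  ultimately have "S \<inter> G = S" using S(2) unfolding connected_clopen by blast
  then show ?thesis using loc[OF t] t by force
qed

section \<open>Jordan normal forms and generalized eigenspaces\<close>

lemma char_matrix_jordan_matrix_Cons:
  fixes l :: "'a::field"
  shows "char_matrix (jordan_matrix ((k, a) # n_as)) l =
    four_block_mat (char_matrix (jordan_block k a) l) (0\<^sub>m k (sum_list (map fst n_as)))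
      (0\<^sub>m (sum_list (map fst n_as)) k) (char_matrix (jordan_matrix n_as) l)"
  unfolding jordan_matrix_Cons
  by (rule eq_matI) (auto simp: char_matrix_def)

text \<open>Each standard basis vector lies in a Jordan block, and the power of the corresponding nilpotent
  block given by its size kills that vector.\<close>

lemma jordan_matrix_column_annihilated:
  fixes n_as :: "(nat \<times> 'a::field) list"
  assumes "j < sum_list (map fst n_as)"
  shows "\<exists>(k, l) \<in> set n_as. \<forall>i < sum_list (map fst n_as).
           (char_matrix (jordan_matrix n_as) l ^\<^sub>m k) $$ (i, j) = 0"
  using assms
proof (induction n_as arbitrary: j)
  case Nil
  then show ?case by simp
next
  case (Cons na n_as)
  obtain k a where na: "na = (k, a)" by force
  let ?m = "sum_list (map fst n_as)"
  have carr: "char_matrix (jordan_matrix n_as) l \<in> carrier_mat ?m ?m"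
             "char_matrix (jordan_block k a) l \<in> carrier_mat k k" for l
    by (auto simp: char_matrix_def)
  have block: "char_matrix (jordan_matrix ((k, a) # n_as)) l ^\<^sub>m r =
      four_block_mat (char_matrix (jordan_block k a) l ^\<^sub>m r) (0\<^sub>m k ?m)
        (0\<^sub>m ?m k) (char_matrix (jordan_matrix n_as) l ^\<^sub>m r)" for l r
    unfolding char_matrix_jordan_matrix_Cons by (rule pow_four_block_mat[OF carr(2) carr(1)])
  note dims = carrier_matD[OF carr(1)] carrier_matD[OF carr(2)]
  have nilpotent: "(char_matrix (jordan_block k a) a ^\<^sub>m k) $$ (i, j) = 0" if "i < k" "j < k" for i j
    using that by (auto simp: char_matrix_jordan_block jordan_block_zero_pow)
  show ?case
  proof (cases "j < k")
    case True
    have "(char_matrix (jordan_matrix (na # n_as)) a ^\<^sub>m k) $$ (i, j) = 0"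
      if "i < k + ?m" for i
      using True that unfolding na block
      by (subst index_mat_four_block(1)) (auto simp: dims nilpotent)
    then show ?thesis unfolding na by (intro bexI[of _ "(k, a)"]) (auto simp: na)
  next
    case False
    then have j: "j - k < ?m" using Cons.prems na by auto
    from Cons.IH[OF this] obtain k' l where kl: "(k', l) \<in> set n_as"
      and z: "\<And>i. i < ?m \<Longrightarrow> (char_matrix (jordan_matrix n_as) l ^\<^sub>m k') $$ (i, j - k) = 0"
      by auto
    have "(char_matrix (jordan_matrix (na # n_as)) l ^\<^sub>m k') $$ (i, j) = 0"
      if "i < k + ?m" for i
      using False j that z[of "i - k"] unfolding na block
      by (subst index_mat_four_block(1)) (auto simp: dims)
    then show ?thesis using kl by (intro bexI[of _ "(k', l)"]) (auto simp: na)
  qed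
qed

text \<open>The coordinate vector of \<open>x\<close> for the enumeration of the index type that also defines
  \<^const>\<open>to_jnf_mat\<close>.\<close>

definition to_jnf_vec :: "complex ^ 'n \<Rightarrow> complex Matrix.vec" where
  "to_jnf_vec x = Matrix.vec CARD('n) (\<lambda>i. x $ from_nat_into UNIV i)"

lemma bij_index: "bij_betw (from_nat_into (UNIV :: 'n::finite set)) {..<CARD('n)} UNIV"
  by (rule bij_betw_from_nat_into_finite) simp

lemma obtain_index:
  obtains j where "j < CARD('n)" "from_nat_into UNIV j = (i :: 'n::finite)"
  using bij_index[where 'n='n] unfolding bij_betw_def by (metis imageE lessThan_iff UNIV_I)

lemma dim_to_jnf_vec [simp]: "to_jnf_vec (x :: complex ^ 'n) \<in> carrier_vec CARD('n)"
  "dim_vec (to_jnf_vec (x :: complex ^ 'n)) = CARD('n)"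
  by (auto simp: to_jnf_vec_def)

lemma to_jnf_mat_carrier [simp]: "to_jnf_mat (M :: complex ^ 'n ^ 'n) \<in> carrier_mat CARD('n) CARD('n)"
  "dim_row (to_jnf_mat (M :: complex ^ 'n ^ 'n)) = CARD('n)"
  "dim_col (to_jnf_mat (M :: complex ^ 'n ^ 'n)) = CARD('n)"
  by (auto simp: to_jnf_mat_def)

lemma to_jnf_vec_eq_iff: "to_jnf_vec x = to_jnf_vec y \<longleftrightarrow> x = (y :: complex ^ 'n)"
proof
  assume eq: "to_jnf_vec x = to_jnf_vec y"
  show "x = y"
  proof (rule Finite_Cartesian_Product.vec_eq_iff[THEN iffD2], rule allI)
    fix i :: 'n
    obtain j where "j < CARD('n)" "from_nat_into UNIV j = i" by (rule obtain_index)
    then show "x $ i = y $ i"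
      using arg_cong[OF eq, of "\<lambda>v. vec_index v j"] by (auto simp: to_jnf_vec_def)
  qed
qed simp

lemma to_jnf_vec_surj:
  assumes "v \<in> carrier_vec CARD('n)"
  obtains x :: "complex ^ 'n" where "to_jnf_vec x = v"
proof
  let ?idx = "inv_into {..<CARD('n)} (from_nat_into (UNIV :: 'n set))"
  show "to_jnf_vec (\<chi> i :: 'n. vec_index v (?idx i)) = v"
  proof (rule eq_vecI)
    fix j assume "j < dim_vec v"
    then have "j \<in> {..<CARD('n)}" using assms by auto
    then show "vec_index (to_jnf_vec (\<chi> i :: 'n. vec_index v (?idx i))) j = vec_index v j"
      using bij_betw_inv_into_left[OF bij_index[where 'n='n], of j]
      by (auto simp: to_jnf_vec_def)
  qed (use assms in auto)
qed

lemma to_jnf_mat_mult_vec: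
  "to_jnf_mat M *\<^sub>v to_jnf_vec x = to_jnf_vec (M *v x)" for M :: "complex ^ 'n ^ 'n"
proof (rule eq_vecI)
  fix i assume i: "i < dim_vec (to_jnf_vec (M *v x))"
  have "(\<Sum>k\<in>UNIV. M $ from_nat_into UNIV i $ k * x $ k) =
        (\<Sum>k\<in>{..<CARD('n)}. M $ from_nat_into UNIV i $ from_nat_into UNIV k * x $ from_nat_into UNIV k)"
    by (rule sum.reindex_bij_betw[OF bij_index, symmetric])
  then show "vec_index (to_jnf_mat M *\<^sub>v to_jnf_vec x) i = vec_index (to_jnf_vec (M *v x)) i"
    using i by (auto simp: to_jnf_mat_def to_jnf_vec_def scalar_prod_def matrix_vector_mult_def
        lessThan_atLeast0)
qed auto

lemma char_matrix_to_jnf_mat: "char_matrix (to_jnf_mat A) l = to_jnf_mat (A - mat l)"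
proof (rule eq_matI)
  fix i j assume ij: "i < dim_row (to_jnf_mat (A - mat l))" "j < dim_col (to_jnf_mat (A - mat l))"
  then have "from_nat_into (UNIV :: 'a set) i = from_nat_into UNIV j \<longleftrightarrow> i = j"
    using bij_index[where 'n='a] by (auto simp: bij_betw_def inj_on_def)
  then show "char_matrix (to_jnf_mat A) l $$ (i, j) = to_jnf_mat (A - mat l) $$ (i, j)"
    using ij by (auto simp: char_matrix_def to_jnf_mat_def Finite_Cartesian_Product.mat_def)
qed (auto simp: char_matrix_def)

lemma matrix_power_commute: "matrix_power M k ** M = M ** matrix_power M k"
  by (induction k) (auto simp: matrix_mul_assoc[symmetric])

lemma to_jnf_mat_pow_mult_vec:
  "to_jnf_mat M ^\<^sub>m k *\<^sub>v to_jnf_vec x = to_jnf_vec (matrix_power M k *v x)"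
proof (induction k arbitrary: x)
  case (Suc k)
  have "to_jnf_mat M ^\<^sub>m Suc k *\<^sub>v to_jnf_vec x = to_jnf_mat M ^\<^sub>m k *\<^sub>v to_jnf_vec (M *v x)"
    by (auto simp: assoc_mult_mat_vec[OF pow_carrier_mat[OF to_jnf_mat_carrier(1)]
          to_jnf_mat_carrier(1)] to_jnf_mat_mult_vec)
  then show ?case
    using Suc[of "M *v x"] by (simp add: matrix_vector_mul_assoc matrix_power_commute)
qed simp

lemma finite_eigenvalues: "finite (eigenvalues A)"
proof -
  have "eigenvalues A \<subseteq> spectrum (to_jnf_mat A)"
  proof
    fix l assume "l \<in> eigenvalues A"
    then obtain v where v: "v \<noteq> 0" "A *v v = l *s v" by (auto simp: eigenvalues_def)
    have "to_jnf_vec v \<noteq> 0\<^sub>v CARD('a)"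
    proof
      assume "to_jnf_vec v = 0\<^sub>v CARD('a)"
      also have "\<dots> = to_jnf_vec (0 :: complex ^ 'a)" by (auto simp: to_jnf_vec_def)
      finally show False using v by (simp add: to_jnf_vec_eq_iff)
    qed
    moreover have "to_jnf_mat A *\<^sub>v to_jnf_vec v = l \<cdot>\<^sub>v to_jnf_vec v"
      unfolding to_jnf_mat_mult_vec v(2) by (auto simp: to_jnf_vec_def)
    ultimately show "l \<in> spectrum (to_jnf_mat A)"
      unfolding spectrum_def eigenvalue_def eigenvector_def
      by (intro CollectI exI[of _ "to_jnf_vec v"]) auto
  qed
  then show ?thesis
    using card_finite_spectrum(1)[OF to_jnf_mat_carrier(1)] by (rule finite_subset)
qed

lemma matrix_power_kernel_mono:
  assumes "matrix_power M k *v x = 0" "k \<le> m"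
  shows "matrix_power M m *v x = 0"
  using assms(2,1)
  by (induction m rule: dec_induct) (auto simp: matrix_vector_mul_assoc[symmetric])

lemma mat_mult_vec: "mat l *v x = l *s x"
  for x :: "'a::semiring_1 ^ 'n"
  by (auto simp: Finite_Cartesian_Product.vec_eq_iff matrix_vector_mult_def Finite_Cartesian_Product.mat_def if_distrib if_distribR sum.delta cong: if_cong)

lemma eigenvalue_if_power_kernel:
  assumes "matrix_power (A - mat l) k *v x = 0" "x \<noteq> 0"
  shows "l \<in> eigenvalues A"
  using assms
proof (induction k)
  case (Suc k)
  show ?case
  proof (cases "matrix_power (A - mat l) k *v x = 0")
    case True
    then show ?thesis using Suc by auto
  next
    case False
    have "(A - mat l) *v (matrix_power (A - mat l) k *v x) = 0"
      using Suc.prems by (simp add: matrix_vector_mul_assoc)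
    then show ?thesis using False
      unfolding eigenvalues_def by (auto simp: matrix_vector_mult_diff_rdistrib mat_mult_vec)
  qed
qed simp

text \<open>The greatest block size exists since block sizes are bounded by the algebraic multiplicity of
  the eigenvalue; hence it dominates the blocks of any particular Jordan form.\<close>

lemma le_largest_jordan_block:
  assumes "jordan_nf (to_jnf_mat A) n_as" "(k, l) \<in> set n_as"
  shows "k \<le> largest_jordan_block A l"
  unfolding largest_jordan_block_def
  by (rule Greatest_le_nat[where b = "Polynomial.order l (char_poly (to_jnf_mat A))"])
     (use assms jordan_nf_block_size_order_bound in blast)+

text \<open>The space is the sum of the generalized eigenspaces: the columns of a matrix that brings \<open>A\<close> to
  Jordan form are generalized eigenvectors, and they form a basis.\<close>

lemma generalized_eigenspaces_span:
  fixes A :: "complex ^ 'n ^ 'n"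
  assumes W: "vec.subspace W"
    and sub: "\<And>l. l \<in> eigenvalues A \<Longrightarrow> generalized_eigenspace A l \<subseteq> W"
  shows "W = UNIV"
proof -
  let ?A = "to_jnf_mat A" and ?n = "CARD('n)"
  obtain as where "char_poly ?A = (\<Prod>a\<leftarrow>as. [:- a, 1:])"
    using char_poly_factorized[of ?A ?n] by auto
  then obtain n_as where jnf: "jordan_nf ?A n_as"
    using jordan_nf_exists[of ?A ?n as] by auto
  let ?J = "jordan_matrix n_as"
  obtain P Q where sim: "similar_mat_wit ?A ?J P Q"
    using jnf unfolding jordan_nf_def similar_mat_def by auto
  note wit = similar_mat_witD2[OF to_jnf_mat_carrier(1) sim]
  have J: "?J \<in> carrier_mat ?n ?n" and P: "P \<in> carrier_mat ?n ?n" and Q: "Q \<in> carrier_mat ?n ?n"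
    and PQ: "P * Q = 1\<^sub>m ?n" and QP: "Q * P = 1\<^sub>m ?n" using wit by auto
  have n: "sum_list (map fst n_as) = ?n" using J by auto
  have "\<exists>p :: complex ^ 'n. to_jnf_vec p = col P j" if "j < ?n" for j
    using to_jnf_vec_surj[of "col P j"] P by (metis col_dim carrier_matD(1))
  then obtain p :: "nat \<Rightarrow> complex ^ 'n" where p: "\<And>j. j < ?n \<Longrightarrow> to_jnf_vec (p j) = col P j"
    by metis
  have pW: "p j \<in> W" if j: "j < ?n" for j
  proof (cases "p j = 0")
    case True
    then show ?thesis using W by (simp add: vec.subspace_0)
  next
    case False
    obtain k l where kl: "(k, l) \<in> set n_as"
      and zero: "\<And>i. i < ?n \<Longrightarrow> (char_matrix ?J l ^\<^sub>m k) $$ (i, j) = 0"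
      using jordan_matrix_column_annihilated[of j n_as] j n by auto
    have cJ: "char_matrix ?J l \<in> carrier_mat ?n ?n" using J by (auto simp: char_matrix_def)
    have "similar_mat_wit (char_matrix ?A l) (char_matrix ?J l) P Q"
      by (rule similar_mat_wit_char_matrix[OF sim])
    from similar_mat_wit_pow[OF this, of k]
    have eq: "char_matrix ?A l ^\<^sub>m k = P * (char_matrix ?J l ^\<^sub>m k) * Q"
      by (auto simp: similar_mat_wit_def Let_def)
    have u: "unit_vec ?n j \<in> carrier_vec ?n" by simp
    have col: "col P j = P *\<^sub>v unit_vec ?n j"
      using P j by (intro eq_vecI) auto
    have "char_matrix ?J l ^\<^sub>m k *\<^sub>v unit_vec ?n j = 0\<^sub>v ?n"
      using zero j carrier_matD[OF pow_carrier_mat[OF cJ, of k]] by (intro eq_vecI) auto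
    moreover have "char_matrix ?A l ^\<^sub>m k *\<^sub>v col P j
        = P *\<^sub>v (char_matrix ?J l ^\<^sub>m k *\<^sub>v (Q * P *\<^sub>v unit_vec ?n j))"
      unfolding eq col using P Q u pow_carrier_mat[OF cJ, of k] by (simp add: assoc_mult_mat_vec[where ?n\<^sub>1.0="?n" and ?n\<^sub>2.0="?n"  and ?n\<^sub>3.0="?n"])
    ultimately have "char_matrix ?A l ^\<^sub>m k *\<^sub>v to_jnf_vec (p j) = 0\<^sub>v ?n"
      using P j unfolding p[OF j] QP by (auto simp: )
    then have "to_jnf_vec (matrix_power (A - mat l) k *v p j) = to_jnf_vec (0 :: complex ^ 'n)"
      by (simp add: char_matrix_to_jnf_mat to_jnf_mat_pow_mult_vec) (auto simp: to_jnf_vec_def)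
    then have ker: "matrix_power (A - mat l) k *v p j = 0"
      by (simp add: to_jnf_vec_eq_iff)
    have "p j \<in> generalized_eigenspace A l"
      unfolding generalized_eigenspace_def
      using matrix_power_kernel_mono[OF ker le_largest_jordan_block[OF jnf kl]] by simp
    then show ?thesis using sub eigenvalue_if_power_kernel[OF ker False] by auto
  qed
  have "x \<in> W" for x :: "complex ^ 'n"
  proof -
    let ?y = "Q *\<^sub>v to_jnf_vec x"
    have "to_jnf_vec x = P *\<^sub>v ?y"
      using P Q PQ by (simp add: assoc_mult_mat_vec[symmetric, where ?n\<^sub>1.0="?n" and ?n\<^sub>2.0="?n"  and ?n\<^sub>3.0="?n"])
    also have "\<dots> = to_jnf_vec (\<Sum>j<?n. vec_index ?y j *s p j)"
    proof (rule eq_vecI)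
      fix i assume "i < dim_vec (to_jnf_vec (\<Sum>j<?n. vec_index ?y j *s p j))"
      then have i: "i < ?n" by simp
      have "p j $ from_nat_into UNIV i = P $$ (i, j)" if "j < ?n" for j
        using arg_cong[OF p[OF that], of "\<lambda>v. vec_index v i"] i that P
        by (auto simp: to_jnf_vec_def)
      then show "vec_index (P *\<^sub>v ?y) i = vec_index (to_jnf_vec (\<Sum>j<?n. vec_index ?y j *s p j)) i"
        using i P Q by (auto simp: to_jnf_vec_def scalar_prod_def lessThan_atLeast0 mult.commute
            intro!: sum.cong)
    qed (use P in auto)
    finally have "x = (\<Sum>j<?n. vec_index ?y j *s p j)" by (simp add: to_jnf_vec_eq_iff)
    also have "\<dots> \<in> W"
      by (intro vec.subspace_sum[OF W] vec.subspace_scale[OF W] pW) auto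
    finally show "x \<in> W" .
  qed
  then show ?thesis by auto
qed

section \<open>Approximation on polydiscs and on star-shaped domains\<close>

lemma has_derivative_vec:
  fixes \<gamma> d :: "'a::real_normed_vector \<Rightarrow> complex ^ 'n"
  assumes "\<And>i. ((\<lambda>t. \<gamma> t $ i) has_derivative (\<lambda>h. d h $ i)) (at t)"
  shows "(\<gamma> has_derivative d) (at t)"
proof (subst has_derivative_componentwise_within, rule ballI)
  fix b :: "complex ^ 'n" assume "b \<in> Basis"
  then obtain i u where b: "b = axis i u" by (auto simp: Basis_vec_def)
  show "((\<lambda>x. \<gamma> x \<bullet> b) has_derivative (\<lambda>x. d x \<bullet> b)) (at t)"
    unfolding b inner_axis by (rule has_derivative_inner_left[OF assms])
qed

lemma holomorphic_Cn_compose_curve: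
  assumes f: "holomorphic_Cn f \<Omega>" and \<gamma>: "\<gamma> t \<in> \<Omega>"
    and \<gamma>': "\<And>i. (\<lambda>s. \<gamma> s $ i) field_differentiable at t"
  shows "(\<lambda>s. f (\<gamma> s)) field_differentiable at t"
proof -
  obtain f' where f': "(f has_derivative f') (at (\<gamma> t))" "\<And>c v. f' (c *s v) = c * f' v"
    using f \<gamma> unfolding holomorphic_Cn_def by blast
  obtain d where d: "\<And>i. ((\<lambda>s. \<gamma> s $ i) has_field_derivative d i) (at t)"
    using \<gamma>' unfolding field_differentiable_def by metis
  have "(\<gamma> has_derivative (\<lambda>h. h *s (\<chi> i. d i))) (at t)"
    by (rule has_derivative_vec) (use d in \<open>simp add: has_field_derivative_def mult_commute_abs\<close>)
  from diff_chain_at[OF this f'(1)]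
  have "((\<lambda>s. f (\<gamma> s)) has_field_derivative f' (\<chi> i. d i)) (at t)"
    by (simp add: has_field_derivative_def o_def f'(2) mult.commute[of _ "f' _"])
  then show ?thesis unfolding field_differentiable_def by blast
qed

lemma holomorphic_Cn_continuous_on: "holomorphic_Cn f \<Omega> \<Longrightarrow> continuous_on \<Omega> f"
  unfolding holomorphic_Cn_def
  by (meson continuous_at_imp_continuous_on has_derivative_continuous)

lemma norm_vec_le_sum: "norm z \<le> (\<Sum>i\<in>UNIV. norm (z $ i))" for z :: "complex ^ 'n"
  unfolding norm_vec_def by (rule L2_set_le_sum) simp

lemma compact_polydisc: "compact {z :: complex ^ 'n. \<forall>i. norm (z $ i) \<le> R}"
  unfolding compact_eq_bounded_closed
proof
  have "norm z \<le> (\<Sum>i\<in>(UNIV :: 'n set). R)" if "\<forall>i. norm (z $ i) \<le> R" for z :: "complex ^ 'n"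
    by (rule order_trans[OF norm_vec_le_sum sum_mono]) (use that in auto)
  then show "bounded {z :: complex ^ 'n. \<forall>i. norm (z $ i) \<le> R}"
    unfolding bounded_iff by blast
  show "closed {z :: complex ^ 'n. \<forall>i. norm (z $ i) \<le> R}"
    by (intro closed_Collect_all closed_Collect_le continuous_intros)
qed

text \<open>A function holomorphic near a closed polydisc is a uniform limit of polynomials on a smaller one.
  The coordinates are released one at a time: with all coordinates frozen at a point \<open>c\<close> the
  function is constant, and releasing the coordinate \<open>i\<close> amounts to substituting \<open>z $ i\<close> for the
  parameter in the one-parameter family of functions frozen at varying values of that coordinate.\<close>

lemma poly_approx_polydisc:
  fixes f :: "complex ^ 'n \<Rightarrow> complex"
  assumes f: "holomorphic_Cn f \<Omega>" and R: "R > 0"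
    and P: "{z. \<forall>i. norm (z $ i) \<le> R} \<subseteq> \<Omega>"
  shows "poly_approx {z. \<forall>i. norm (z $ i) \<le> R / 2} f"
proof -
  let ?P = "{z :: complex ^ 'n. \<forall>i. norm (z $ i) \<le> R}"
  let ?K = "{z :: complex ^ 'n. \<forall>i. norm (z $ i) \<le> R / 2}"
  have "bounded (f ` ?P)"
    by (intro compact_imp_bounded compact_continuous_image compact_polydisc
        continuous_on_subset[OF holomorphic_Cn_continuous_on[OF f] P])
  then obtain M where "\<forall>w\<in>f ` ?P. norm w \<le> M" unfolding bounded_iff by blast
  then have M: "norm (f z) \<le> M" if "z \<in> ?P" for z using that by blast
  have "poly_approx ?K (\<lambda>z. f (\<chi> j. if j \<in> I then z $ j else c $ j))"
    if "finite I" "c \<in> ?P" for I c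
    using that
  proof (induction I arbitrary: c)
    case empty
    then show ?case by (simp add: poly_approx_const)
  next
    case (insert i I)
    define F where "F s z = f (\<chi> j. if j \<in> I then z $ j else if j = i then s else c $ j)"
      for s and z :: "complex ^ 'n"
    have inP: "(\<chi> j. if j \<in> I then z $ j else if j = i then s else c $ j) \<in> ?P"
      if "s \<in> cball 0 R" "z \<in> ?K" for s z
    proof -
      have "norm (z $ j) \<le> R" for j using that(2) R by (simp add: order_trans[of _ "R / 2"])
      then show ?thesis using that insert.prems by auto
    qed
    have K: "compact ?K" by (rule compact_polydisc)
    have coord: "(\<lambda>s. (\<chi> j. if j \<in> I then z $ j else if j = i then s else c $ j) $ k)
        field_differentiable at s" for k s and z :: "complex ^ 'n"
      by (cases "k \<in> I"; cases "k = i") simp_all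
    have hol: "(\<lambda>s. F s z) holomorphic_on cball 0 R" if z: "z \<in> ?K" for z
      unfolding holomorphic_on_def
    proof (rule ballI, rule field_differentiable_at_within)
      fix s assume s: "s \<in> cball (0 :: complex) R"
      show "(\<lambda>s. F s z) field_differentiable at s"
        unfolding F_def
        by (rule holomorphic_Cn_compose_curve[OF f,
              where \<gamma> = "\<lambda>s. \<chi> j. if j \<in> I then z $ j else if j = i then s else c $ j"])
           (rule subsetD[OF P inP[OF s z]], rule coord)
    qed
    have bound: "norm (F s z) \<le> M" if "s \<in> cball 0 R" "z \<in> ?K" for s z
      unfolding F_def by (rule M[OF inP[OF that]])
    have "poly_approx ?K (F s)" if s: "s \<in> ball 0 R" for s
    proof -
      have "(\<chi> j. if j = i then s else c $ j) \<in> ?P" using s insert.prems by auto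
      from insert.IH[OF this] show ?thesis unfolding F_def by (simp cong: if_cong)
    qed
    then have "ball 0 R \<subseteq> {s. poly_approx ?K (F s)}" by blast
    moreover have "0 islimpt ball (0 :: complex) R"
      using R by (simp add: islimpt_ball)
    ultimately have lim: "0 islimpt {s. poly_approx ?K (F s)}" by (rule islimpt_subset[rotated])
    have "poly_approx ?K (\<lambda>z. F (z $ i) z)"
      by (rule poly_approx_disc[where \<rho> = "R / 2", OF K R hol bound lim])
        (use R in \<open>auto intro: poly_approx_if_polynomial holomorphic_polynomial_coord\<close>)
    then show ?case
      by (rule poly_approx_cong[THEN iffD1, rotated])
        (auto simp: F_def intro!: arg_cong[where f = f] simp: Finite_Cartesian_Product.vec_eq_iff)
  qed
  from this[of UNIV 0] R show ?thesis by simp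
qed

text \<open>Approximability of \<open>f \<circ> \<Psi> t\<close> propagates along a compact convex set \<open>C\<close> of parameters for which
  \<open>\<Psi> t\<close> maps \<open>K\<close> into the domain of \<open>f\<close>. By compactness the same holds in a neighbourhood \<open>S\<close> of
  \<open>C\<close> in the plane, with a uniform bound on \<open>f \<circ> \<Psi> t\<close>.\<close>

lemma poly_approx_along_path:
  fixes \<Psi> :: "complex \<Rightarrow> complex ^ 'n \<Rightarrow> complex ^ 'n"
  assumes \<Omega>: "open \<Omega>" and f: "holomorphic_Cn f \<Omega>"
    and K: "compact K" and C: "compact C" "convex C"
    and cont: "continuous_on UNIV (\<lambda>(t, z). \<Psi> t z)"
    and hol: "\<And>z i t. (\<lambda>t. \<Psi> t z $ i) field_differentiable at t"
    and sub: "\<And>t z. t \<in> C \<Longrightarrow> z \<in> K \<Longrightarrow> \<Psi> t z \<in> \<Omega>"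
    and t0: "t0 \<in> C" "t0 islimpt {s. poly_approx K (\<lambda>z. f (\<Psi> s z))}"
    and t: "t \<in> C"
  shows "poly_approx K (\<lambda>z. f (\<Psi> t z))"
proof -
  let ?W = "(\<lambda>(t, z). \<Psi> t z) -` \<Omega>"
  have "open ?W" using \<Omega> cont by (simp add: continuous_on_open_vimage)
  moreover have "compact (C \<times> K)" using C K by (simp add: compact_Times)
  moreover have "C \<times> K \<subseteq> ?W" using sub by auto
  ultimately obtain \<epsilon> where \<epsilon>: "\<epsilon> > 0" "(\<Union>x\<in>C \<times> K. cball x \<epsilon>) \<subseteq> ?W"
    using compact_subset_open_imp_cball_epsilon_subset[of "C \<times> K" ?W] by blast
  define S where "S = (\<Union>x\<in>C. \<Union>y\<in>ball 0 \<epsilon>. {x + y})"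
  define S' where "S' = {x + y | x y. x \<in> C \<and> y \<in> cball 0 \<epsilon>}"
  have S: "open S" "connected S" "C \<subseteq> S" "S \<subseteq> S'"
  proof -
    show "open S" unfolding S_def by (intro open_sums) auto
    show "connected S" unfolding S_def by (intro convex_connected convex_sums C convex_ball)
    show "C \<subseteq> S" using \<epsilon>(1) by (force simp: S_def)
    show "S \<subseteq> S'" by (force simp: S_def S'_def)
  qed
  have in\<Omega>: "\<Psi> s z \<in> \<Omega>" if s: "s \<in> S'" and z: "z \<in> K" for s z
  proof -
    obtain x y where "s = x + y" "x \<in> C" "y \<in> cball 0 \<epsilon>"
      using s unfolding S'_def by blast
    then have "(x, z) \<in> C \<times> K" "(s, z) \<in> cball (x, z) \<epsilon>"
      using z by (auto simp: dist_Pair_Pair dist_norm)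
    then have "(s, z) \<in> (\<Union>x\<in>C \<times> K. cball x \<epsilon>)" by (rule UN_I)
    from subsetD[OF \<epsilon>(2) this] show ?thesis by simp
  qed
  have "compact (S' \<times> K)"
    unfolding S'_def by (intro compact_Times compact_sums C K compact_cball)
  moreover have "continuous_on (S' \<times> K) (\<lambda>x. f (case x of (t, z) \<Rightarrow> \<Psi> t z))"
    by (rule continuous_on_compose2[OF holomorphic_Cn_continuous_on[OF f] continuous_on_subset[OF cont]])
      (use in\<Omega> in auto)
  ultimately have "bounded ((\<lambda>x. f (case x of (t, z) \<Rightarrow> \<Psi> t z)) ` (S' \<times> K))"
    using compact_continuous_image compact_imp_bounded by blast
  then obtain M where M: "\<And>s z. s \<in> S' \<Longrightarrow> z \<in> K \<Longrightarrow> norm (f (\<Psi> s z)) \<le> M"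
    unfolding bounded_iff by (auto simp: ball_Un)
  show ?thesis
  proof (rule poly_approx_continuation[OF K S(1,2), where F = "\<lambda>s z. f (\<Psi> s z)" and M = M and ?t0.0 = t0])
    show "(\<lambda>s. f (\<Psi> s z)) holomorphic_on S" if "z \<in> K" for z
      unfolding holomorphic_on_def
    proof (rule ballI, rule field_differentiable_at_within)
      fix s assume "s \<in> S"
      then show "(\<lambda>s. f (\<Psi> s z)) field_differentiable at s"
        using S(4) by (intro holomorphic_Cn_compose_curve[OF f, where \<gamma> = "\<lambda>s. \<Psi> s z"] in\<Omega> that hol) auto
    qed
  qed (use S M t0 t in auto)
qed

text \<open>The function \<open>f (s (B z))\<close> is continued in \<open>s\<close> from a neighbourhood of \<open>0\<close>, where \<open>s (B z)\<close> stays in a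
  small polydisc, to \<open>s = 1\<close>.\<close>

lemma poly_approx_starlike:
  fixes f :: "complex ^ 'n \<Rightarrow> complex" and B :: "complex ^ 'n ^ 'n"
  assumes \<Omega>: "open \<Omega>" "0 \<in> \<Omega>" and f: "holomorphic_Cn f \<Omega>" and K: "compact K"
    and star: "\<And>s z. 0 \<le> s \<Longrightarrow> s \<le> 1 \<Longrightarrow> z \<in> K \<Longrightarrow> complex_of_real s *s (B *v z) \<in> \<Omega>"
  shows "poly_approx K (\<lambda>z. f (B *v z))"
proof -
  obtain e where e: "e > 0" "ball 0 e \<subseteq> \<Omega>" using \<Omega> open_contains_ball by blast
  \<comment> \<open>A point whose coordinates have modulus at most \<open>R\<close> has norm at most \<open>e / 2\<close>.\<close>
  define R where "R = e / (2 * CARD('n))"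
  have R: "R > 0" using e by (simp add: R_def)
  have "z \<in> \<Omega>" if "\<forall>i. norm (z $ i) \<le> R" for z :: "complex ^ 'n"
  proof -
    have "norm z \<le> (\<Sum>i\<in>(UNIV :: 'n set). R)"
      by (rule order_trans[OF norm_vec_le_sum sum_mono]) (use that in auto)
    also have "\<dots> < e" using e by (simp add: R_def)
    finally show ?thesis using e by auto
  qed
  then have poly: "poly_approx {z. \<forall>i. norm (z $ i) \<le> R / 2} f"
    by (intro poly_approx_polydisc[OF f R]) auto
  have "continuous_on K (\<lambda>z. B *v z)"
    by (intro linear_continuous_on) (simp add: linear_linear)
  then have "bounded ((\<lambda>z. B *v z) ` K)"
    using K by (intro compact_imp_bounded compact_continuous_image)
  then obtain L where L: "L > 0" "\<And>z. z \<in> K \<Longrightarrow> norm (B *v z) \<le> L"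
    unfolding bounded_pos by auto
  have "poly_approx K (\<lambda>z. f (s *s (B *v z)))" if s: "s \<in> ball 0 (R / (2 * L))" for s
  proof -
    have "(mat s ** B) *v z \<in> {z. \<forall>i. norm (z $ i) \<le> R / 2}" if z: "z \<in> K" for z
    proof -
      have "norm (s * (B *v z) $ i) \<le> R / 2" for i
      proof -
        have "norm (s * (B *v z) $ i) \<le> R / (2 * L) * L"
          unfolding norm_mult using s L R order_trans[OF Finite_Cartesian_Product.norm_nth_le[of "B *v z" i] L(2)[OF z]]
          by (intro mult_mono) auto
        then show ?thesis using L(1) by simp
      qed
      then show ?thesis by (simp add: matrix_vector_mul_assoc[symmetric] mat_mult_vec)
    qed
    from poly_approx_matrix[OF poly this] show ?thesis
      by (simp add: matrix_vector_mul_assoc[symmetric] mat_mult_vec)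
  qed
  moreover have "0 islimpt ball (0 :: complex) (R / (2 * L))" using R L by (simp add: islimpt_ball)
  ultimately have lim: "0 islimpt {s. poly_approx K (\<lambda>z. f (s *s (B *v z)))}"
    by (auto intro: islimpt_subset)
  have "poly_approx K (\<lambda>z. f (1 *s (B *v z)))"
  proof (rule poly_approx_along_path[OF \<Omega>(1) f K, where t = 1 and C = "complex_of_real ` {0..1}" and ?t0.0 = 0 and \<Psi> = "\<lambda>s z. s *s (B *v z)"])
    show "compact (complex_of_real ` {0..1})"
      by (intro compact_continuous_image continuous_intros) auto
    show "convex (complex_of_real ` {0..1})"
      by (intro convex_linear_image) (auto simp: linear_of_real)
    show "continuous_on UNIV (\<lambda>(s, z). s *s (B *v z))"
      unfolding matrix_vector_mult_def vector_scalar_mult_def split_def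
      by (intro continuous_on_vec_lambda continuous_intros)
    show "(\<lambda>s. (s *s (B *v z)) $ i) field_differentiable at s" for z s i
      by (auto intro!: derivative_intros)
    show "0 islimpt {s. poly_approx K (\<lambda>z. f (s *s (B *v z)))}" by (rule lim)
    show "1 \<in> complex_of_real ` {0..1}" by (rule image_eqI[of _ _ 1]) auto
  qed (use star in auto)
  then show ?thesis by simp
qed

section \<open>The linear flow in complex time\<close>

text \<open>The flow \<open>exp (t A) x\<close> for complex time \<open>t\<close>, given by the power series of each coordinate. It is
  defined on vectors rather than as a matrix, so that its coordinates are power series in one
  complex variable.\<close>

definition flow :: "complex ^ 'n ^ 'n \<Rightarrow> complex \<Rightarrow> complex ^ 'n \<Rightarrow> complex ^ 'n" where
  "flow A t x = (\<chi> i. \<Sum>k. ((matrix_power A k *v x) $ i / fact k) * t ^ k)"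

lemma matrix_power_entry_bound:
  fixes A :: "complex ^ 'n ^ 'n"
  defines "c \<equiv> (\<Sum>i\<in>UNIV. \<Sum>j\<in>UNIV. norm (A $ i $ j))"
  shows "norm (matrix_power A k $ i $ j) \<le> c ^ k"
proof (induction k arbitrary: i)
  case 0
  then show ?case by (simp add: Finite_Cartesian_Product.mat_def)
next
  case (Suc k)
  have "norm (matrix_power A (Suc k) $ i $ j) \<le> (\<Sum>l\<in>UNIV. norm (A $ i $ l) * norm (matrix_power A k $ l $ j))"
    by (simp add: matrix_matrix_mult_def) (metis (no_types, lifting) norm_mult norm_sum sum.cong)
  also have "\<dots> \<le> (\<Sum>l\<in>UNIV. norm (A $ i $ l) * c ^ k)"
    by (intro sum_mono mult_left_mono Suc) auto
  also have "\<dots> = (\<Sum>l\<in>UNIV. norm (A $ i $ l)) * c ^ k" by (simp add: sum_distrib_right)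
  also have "\<dots> \<le> c * c ^ k"
    unfolding c_def
    by (intro mult_right_mono zero_le_power sum_nonneg
        member_le_sum[of i UNIV "\<lambda>i. \<Sum>l\<in>UNIV. norm (A $ i $ l)"]) auto
  finally show ?case by simp
qed

lemma summable_matrix_power_entry:
  fixes A :: "complex ^ 'n ^ 'n"
  shows "summable (\<lambda>k. (matrix_power A k $ i $ j / fact k) * t ^ k)"
proof -
  define c where "c = (\<Sum>i\<in>UNIV. \<Sum>j\<in>UNIV. norm (A $ i $ j))"
  have "summable (\<lambda>k. inverse (fact k) * (c * norm t) ^ k)" by (rule summable_exp)
  moreover have "norm ((matrix_power A k $ i $ j / fact k) * t ^ k) \<le> inverse (fact k) * (c * norm t) ^ k" for k
  proof -
    have "norm (matrix_power A k $ i $ j) * (inverse (fact k) * norm t ^ k)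
        \<le> c ^ k * (inverse (fact k) * norm t ^ k)"
      unfolding c_def by (intro mult_right_mono matrix_power_entry_bound) auto
    then show ?thesis
      by (simp add: norm_mult norm_power norm_inverse power_mult_distrib divide_inverse mult_ac)
  qed
  ultimately show ?thesis by (rule summable_comparison_test'[of _ 0]) 
qed

lemma summable_flow: "summable (\<lambda>k. ((matrix_power A k *v x) $ i / fact k) * t ^ k)"
proof -
  have "((matrix_power A k *v x) $ i / fact k) * t ^ k =
      (\<Sum>j\<in>UNIV. (matrix_power A k $ i $ j / fact k) * t ^ k * x $ j)" for k
    by (simp add: matrix_vector_mult_def sum_distrib_left sum_distrib_right sum_divide_distrib mult_ac)
  then show ?thesis
    by (simp only:) (intro summable_sum summable_mult2 summable_matrix_power_entry)
qed

lemma flow_0 [simp]: "flow A 0 x = x"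
  unfolding flow_def powser_zero by (simp add: Finite_Cartesian_Product.vec_eq_iff)

lemma flow_add: "flow A t (x + y) = flow A t x + flow A t y"
  using suminf_add[OF summable_flow[of A x _ t] summable_flow[of A y _ t]]
  by (simp add: flow_def Finite_Cartesian_Product.vec_eq_iff matrix_vector_right_distrib
      add_divide_distrib distrib_right)

lemma flow_scale: "flow A t (c *s x) = c *s flow A t x"
  using suminf_mult[OF summable_flow, of c A x _ t]
  by (simp add: flow_def Finite_Cartesian_Product.vec_eq_iff vector_scalar_commute mult_ac)

lemma flow_zero_vec [simp]: "flow A t 0 = 0"
  using flow_scale[of A t 0 0] by simp

lemma flow_sum: "flow A t (\<Sum>i\<in>I. x i) = (\<Sum>i\<in>I. flow A t (x i))"
  by (induction I rule: infinite_finite_induct) (auto simp: flow_add)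

lemma has_field_derivative_flow:
  "((\<lambda>t. flow A t x $ i) has_field_derivative flow A t (A *v x) $ i) (at t)"
proof -
  let ?c = "\<lambda>k. (matrix_power A k *v x) $ i / fact k"
  have "((\<lambda>t. \<Sum>k. ?c k * t ^ k) has_field_derivative (\<Sum>k. diffs ?c k * t ^ k)) (at t)"
    by (rule termdiffs_strong_converges_everywhere) (rule summable_flow)
  moreover have "diffs ?c k = (matrix_power A k *v (A *v x)) $ i / fact k" for k
    by (simp add: diffs_def matrix_vector_mul_assoc matrix_power_commute del: of_nat_Suc)
  ultimately show ?thesis by (simp add: flow_def)
qed

lemma flow_expand: "flow A t x = (\<Sum>j\<in>UNIV. x $ j *s flow A t (axis j 1))"
  by (subst basis_expansion[of x, symmetric]) (simp only: flow_sum flow_scale)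

lemma flow_eq_matrix: "flow A t x = (\<chi> i j. flow A t (axis j 1) $ i) *v x"
  by (subst flow_expand) (simp add: Finite_Cartesian_Product.vec_eq_iff matrix_vector_mult_def sum_component mult.commute)

lemma continuous_on_flow:
  fixes A :: "complex ^ 'n ^ 'n"
  shows "continuous_on UNIV (\<lambda>(t, x). flow A t x)"
proof -
  have "continuous_on UNIV (\<lambda>t. flow A t x $ i)" for x i
    by (intro continuous_at_imp_continuous_on ballI DERIV_isCont[OF has_field_derivative_flow])
  then have "continuous_on UNIV (\<lambda>t. \<chi> i. flow A t x $ i)" for x
    by (rule continuous_on_vec_lambda)
  then have "continuous_on UNIV (\<lambda>t. flow A t x)" for x by simp
  then have "continuous_on UNIV (\<lambda>y :: complex \<times> (complex ^ 'n). flow A (fst y) x)" for x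
    by (rule continuous_on_compose2) (auto intro: continuous_intros)
  then show ?thesis
    unfolding split_def flow_eq_matrix[of A _ "snd _"] matrix_vector_mult_def
    by (auto intro!: continuous_intros continuous_on_vec_lambda)
qed

lemma matrix_power_scaleR: "matrix_power (c *\<^sub>R A) k = c ^ k *\<^sub>R matrix_power A k"
  by (induction k) (simp_all add: matrix_matrix_mult_def Finite_Cartesian_Product.vec_eq_iff
      scaleR_sum_right mult.commute)

lemma matrix_exp_eq_flow: "matrix_exp (t *\<^sub>R A) *v x = flow A (of_real t) x"
proof -
  let ?E = "\<chi> i j. \<Sum>k. (matrix_power A k $ i $ j / fact k) * of_real t ^ k"
  have ax: "(matrix_power A k *v axis j 1) $ i = matrix_power A k $ i $ j" for k i j
    by (simp add: matrix_vector_mult_def axis_def if_distrib if_distribR sum.delta cong: if_cong)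
  have "(\<lambda>k. (1 / fact k) *\<^sub>R matrix_power (t *\<^sub>R A) k) sums ?E"
    unfolding sums_def
  proof (intro vec_tendstoI)
    fix i j
    have eq: "((1 / fact k) *\<^sub>R matrix_power (t *\<^sub>R A) k) $ i $ j =
        (matrix_power A k $ i $ j / fact k) * of_real t ^ k" for k
      by (simp add: matrix_power_scaleR scaleR_conv_of_real[where 'a = complex])
    show "(\<lambda>n. (\<Sum>k<n. (1 / fact k) *\<^sub>R matrix_power (t *\<^sub>R A) k) $ i $ j) \<longlonglongrightarrow> ?E $ i $ j"
      using summable_LIMSEQ[OF summable_matrix_power_entry[of A i j "of_real t"]]
      by (simp add: sum_component eq del: vector_scaleR_component)
  qed
  then have "matrix_exp (t *\<^sub>R A) = ?E" unfolding matrix_exp_def by (simp add: sums_iff)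
  then show ?thesis by (subst flow_eq_matrix) (simp add: flow_def ax)
qed

text \<open>Write \<open>N = A - l\<close>. Let \<open>u x s\<close> be the coordinate \<open>i\<close> of \<open>exp (- l s) exp (s A) x\<close>. The
  derivative of \<open>u x\<close> is \<open>u (N x)\<close>, so the Taylor coefficients of \<open>u x\<close> at \<open>0\<close> are the coordinates of
  \<open>N^k x / k!\<close>, which vanish for \<open>k \<ge> m\<close>.\<close>

lemma flow_generalized_eigenvector:
  assumes "matrix_power (A - mat l) m *v x = 0"
  shows "flow A t x $ i =
    exp (l * t) * (\<Sum>k<m. ((matrix_power (A - mat l) k *v x) $ i / fact k) * t ^ k)"
proof -
  let ?N = "A - mat l"
  define u where "u x s = exp (- l * s) * flow A s x $ i" for x s
  have der: "(u x has_field_derivative u (?N *v x) s) (at s)" for x s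
  proof -
    have "(u x has_field_derivative
        (exp (- l * s) * (- l)) * flow A s x $ i + flow A s (A *v x) $ i * exp (- l * s)) (at s)"
      unfolding u_def by (intro DERIV_mult has_field_derivative_flow) (auto intro!: derivative_eq_intros)
    also have "A *v x = ?N *v x + l *s x"
      by (simp add: matrix_vector_mult_diff_rdistrib mat_mult_vec)
    finally show ?thesis
      unfolding u_def flow_add flow_scale by (simp add: algebra_simps)
  qed
  have higher: "(deriv ^^ k) (u x) = u (matrix_power ?N k *v x)" for k
  proof (induction k)
    case (Suc k)
    have "(deriv ^^ Suc k) (u x) = deriv (u (matrix_power ?N k *v x))" by (simp add: Suc)
    also have "\<dots> = u (?N *v (matrix_power ?N k *v x))" using DERIV_imp_deriv[OF der] by blast
    finally show ?case by (simp add: matrix_vector_mul_assoc)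
  qed simp
  have "u x holomorphic_on ball 0 (norm t + 1)"
    unfolding holomorphic_on_def field_differentiable_def
    using der has_field_derivative_at_within by blast
  then have "(\<lambda>k. (deriv ^^ k) (u x) 0 / fact k * (t - 0) ^ k) sums u x t"
    by (rule holomorphic_power_series) auto
  then have "(\<lambda>k. ((matrix_power ?N k *v x) $ i / fact k) * t ^ k) sums u x t"
    by (simp add: higher) (simp add: u_def)
  moreover have "matrix_power ?N k *v x = 0" if "m \<le> k" for k
    using that by (induction k rule: dec_induct)
      (simp_all add: assms matrix_vector_mul_assoc[symmetric])
  then have "(\<lambda>k. ((matrix_power ?N k *v x) $ i / fact k) * t ^ k) sums
      (\<Sum>k<m. ((matrix_power ?N k *v x) $ i / fact k) * t ^ k)"
    by (intro sums_finite) auto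
  ultimately have "u x t = (\<Sum>k<m. ((matrix_power ?N k *v x) $ i / fact k) * t ^ k)"
    by (rule sums_unique2)
  then show ?thesis by (simp add: u_def exp_minus field_simps)
qed

lemma flow_tendsto_0:
  assumes "matrix_power (A - mat l) m *v x = 0" "Re l < 0"
  shows "((\<lambda>t. flow A (complex_of_real t) x) \<longlongrightarrow> 0) at_top"
proof (rule vec_tendstoI)
  fix i
  have lim: "((\<lambda>t. exp (l * of_real t) * (c * of_real t ^ k)) \<longlongrightarrow> 0) at_top" for c k
  proof (rule tendsto_norm_zero_cancel)
    have "((\<lambda>t. exp (Re l * t) * (norm c * t ^ k)) \<longlongrightarrow> 0) at_top"
      using assms(2) by real_asymp
    moreover have "eventually (\<lambda>t. exp (Re l * t) * (norm c * t ^ k) =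
        norm (exp (l * of_real t) * (c * of_real t ^ k))) at_top"
      using eventually_ge_at_top[of 0] by eventually_elim (simp add: norm_mult norm_power)
    ultimately show "((\<lambda>t. norm (exp (l * of_real t) * (c * of_real t ^ k))) \<longlongrightarrow> 0) at_top"
      by (rule Lim_transform_eventually)
  qed
  show "((\<lambda>t. flow A (complex_of_real t) x $ i) \<longlongrightarrow> 0 $ i) at_top"
    unfolding flow_generalized_eigenvector[OF assms(1)] sum_distrib_left
    by (simp only: zero_index) (intro tendsto_null_sum lim)
qed


section \<open>Attraction to the unstable-center subspace\<close>

lemma closed_vec_subspace:
  fixes W :: "(complex ^ 'n) set"
  assumes "vec.subspace W"
  shows "closed W" "convex W"
proof -
  have "c *\<^sub>R x = complex_of_real c *s x" for c and x :: "complex ^ 'n"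
    by (simp add: Finite_Cartesian_Product.vec_eq_iff scaleR_conv_of_real[where 'a = complex])
  then have "Real_Vector_Spaces.subspace W"
    using assms unfolding Real_Vector_Spaces.subspace_def vec.subspace_def by simp
  then show "closed W" "convex W"
    by (simp_all add: closed_subspace subspace_imp_convex)
qed

lemma flow_in_subspace:
  assumes W: "vec.subspace W" and inv: "\<And>x. x \<in> W \<Longrightarrow> A *v x \<in> W" and x: "x \<in> W"
  shows "flow A t x \<in> W"
proof -
  have pow: "matrix_power A k *v x \<in> W" for k
    by (induction k) (use x inv in \<open>simp_all add: matrix_vector_mul_assoc[symmetric]\<close>)
  let ?s = "\<lambda>n. \<Sum>k<n. (t ^ k / fact k) *s (matrix_power A k *v x)"
  have "?s \<longlonglongrightarrow> flow A t x"
  proof (rule vec_tendstoI)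
    fix i
    show "(\<lambda>n. ?s n $ i) \<longlonglongrightarrow> flow A t x $ i"
      using summable_LIMSEQ[OF summable_flow[of A x i t]]
      by (simp add: sum_component flow_def mult_ac)
  qed
  moreover have "?s n \<in> W" for n
    by (intro vec.subspace_sum[OF W] vec.subspace_scale[OF W] pow)
  ultimately show ?thesis
    using closed_sequentially[OF closed_vec_subspace(1)[OF W], of ?s] by blast
qed

lemma subspace_generalized_eigenspace: "vec.subspace (generalized_eigenspace A l)"
  by (simp add: vec.subspace_def generalized_eigenspace_def matrix_vector_right_distrib vector_scalar_commute)

lemma generalized_eigenspace_invariant:
  assumes "x \<in> generalized_eigenspace A l"
  shows "A *v x \<in> generalized_eigenspace A l"
proof -
  let ?N = "A - mat l"
  let ?P = "matrix_power ?N (largest_jordan_block A l)"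
  have "A *v x = ?N *v x + l *s x"
    by (simp add: matrix_vector_mult_diff_rdistrib mat_mult_vec)
  moreover have "?P *v (?N *v x) = ?N *v (?P *v x)"
    by (simp add: matrix_vector_mul_assoc matrix_power_commute)
  ultimately show ?thesis
    using assms by (simp add: generalized_eigenspace_def matrix_vector_right_distrib vector_scalar_commute)
qed

lemma subspace_subspace_sum:
  fixes V :: "'i \<Rightarrow> (complex ^ 'n) set"
  assumes V: "\<And>i. i \<in> I \<Longrightarrow> vec.subspace (V i)"
  shows "vec.subspace (subspace_sum I V)"
  unfolding vec.subspace_def
proof (intro conjI ballI allI)
  show "0 \<in> subspace_sum I V"
    using V unfolding subspace_sum_def by (force intro!: exI[of _ "\<lambda>_. 0"] simp: vec.subspace_0)
next
  fix x y assume "x \<in> subspace_sum I V" "y \<in> subspace_sum I V"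
  then obtain v w where "x = (\<Sum>i\<in>I. v i)" "\<forall>i\<in>I. v i \<in> V i" "y = (\<Sum>i\<in>I. w i)" "\<forall>i\<in>I. w i \<in> V i"
    unfolding subspace_sum_def by blast
  then show "x + y \<in> subspace_sum I V"
    using V unfolding subspace_sum_def
    by (auto intro!: exI[of _ "\<lambda>i. v i + w i"] simp: sum.distrib vec.subspace_add)
next
  fix c x assume "x \<in> subspace_sum I V"
  then obtain v where "x = (\<Sum>i\<in>I. v i)" "\<forall>i\<in>I. v i \<in> V i"
    unfolding subspace_sum_def by blast
  then show "c *s x \<in> subspace_sum I V"
    using V unfolding subspace_sum_def
    by (auto intro!: exI[of _ "\<lambda>i. c *s v i"] simp: vec.scale_sum_right vec.subspace_scale)
qed

lemma subspace_sum_upper: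
  assumes "finite I" "i \<in> I" "\<And>j. j \<in> I \<Longrightarrow> 0 \<in> V j"
  shows "V i \<subseteq> subspace_sum I V"
proof
  fix x assume "x \<in> V i"
  moreover have "x = (\<Sum>j\<in>I. if j = i then x else 0)" using assms by simp
  ultimately show "x \<in> subspace_sum I V"
    unfolding subspace_sum_def using assms by (auto intro!: exI[of _ "\<lambda>j. if j = i then x else 0"])
qed

lemma subspace_sum_invariant:
  fixes V :: "'i \<Rightarrow> (complex ^ 'n) set"
  assumes "\<And>i x. i \<in> I \<Longrightarrow> x \<in> V i \<Longrightarrow> A *v x \<in> V i" "x \<in> subspace_sum I V"
  shows "A *v x \<in> subspace_sum I V"
proof -
  obtain v where v: "x = (\<Sum>i\<in>I. v i)" "\<forall>i\<in>I. v i \<in> V i"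
    using assms(2) unfolding subspace_sum_def by blast
  have "A *v x = (\<Sum>i\<in>I. A *v v i)"
    unfolding v(1) by (induction I rule: infinite_finite_induct) (auto simp: matrix_vector_right_distrib)
  then show ?thesis
    using v assms(1) unfolding subspace_sum_def by blast
qed

lemma unstable_center_subspace_props:
  fixes A :: "complex ^ 'n ^ 'n"
  shows "vec.subspace (unstable_center_subspace A)"
    and "x \<in> unstable_center_subspace A \<Longrightarrow> A *v x \<in> unstable_center_subspace A"
    and "l \<in> eigenvalues A \<Longrightarrow> Re l \<ge> 0 \<Longrightarrow> generalized_eigenspace A l \<subseteq> unstable_center_subspace A"
proof -
  let ?u = "{l \<in> eigenvalues A. Re l > 0}" and ?c = "{l \<in> eigenvalues A. Re l = 0}"
  have sub: "vec.subspace (unstable_subspace A)" "vec.subspace (center_subspace A)"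
    unfolding unstable_subspace_def center_subspace_def
    by (intro subspace_subspace_sum subspace_generalized_eigenspace)+
  show "vec.subspace (unstable_center_subspace A)"
    unfolding unstable_center_subspace_def by (rule vec.subspace_sums[OF sub])
  show "A *v x \<in> unstable_center_subspace A" if x: "x \<in> unstable_center_subspace A"
  proof -
    obtain y z where yz: "x = y + z" "y \<in> unstable_subspace A" "z \<in> center_subspace A"
      using x unfolding unstable_center_subspace_def by blast
    have "A *v y \<in> unstable_subspace A" "A *v z \<in> center_subspace A"
      using yz(2,3) unfolding unstable_subspace_def center_subspace_def
      by (auto intro: subspace_sum_invariant generalized_eigenspace_invariant)
    then show ?thesis
      unfolding unstable_center_subspace_def yz(1) matrix_vector_right_distrib by blast
  qed
  show "generalized_eigenspace A l \<subseteq> unstable_center_subspace A" if l: "l \<in> eigenvalues A" "Re l \<ge> 0"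
  proof
    fix x assume x: "x \<in> generalized_eigenspace A l"
    have "x \<in> unstable_subspace A \<or> x \<in> center_subspace A"
    proof (cases "Re l > 0")
      case True
      then have "generalized_eigenspace A l \<subseteq> unstable_subspace A"
        unfolding unstable_subspace_def using l
        by (intro subspace_sum_upper)
           (auto simp: finite_eigenvalues vec.subspace_0[OF subspace_generalized_eigenspace])
      then show ?thesis using x by blast
    next
      case False
      then have "generalized_eigenspace A l \<subseteq> center_subspace A"
        unfolding center_subspace_def using l
        by (intro subspace_sum_upper)
           (auto simp: finite_eigenvalues vec.subspace_0[OF subspace_generalized_eigenspace])
      then show ?thesis using x by blast
    qed
    then show "x \<in> unstable_center_subspace A"
      using vec.subspace_0[OF sub(1)] vec.subspace_0[OF sub(2)]
      unfolding unstable_center_subspace_def by force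
  qed
qed

text \<open>Vectors of a generalized eigenspace are attracted to \<open>0\<close> if the eigenvalue has negative real
  part, and otherwise belong to the unstable-center subspace.\<close>

lemma stable_plus_unstable_center:
  fixes A :: "complex ^ 'n ^ 'n"
  obtains s c where "x = s + c" "c \<in> unstable_center_subspace A"
    "((\<lambda>t. flow A (complex_of_real t) s) \<longlongrightarrow> 0) at_top"
proof -
  let ?W = "{x. \<exists>s c. x = s + c \<and> c \<in> unstable_center_subspace A \<and>
      ((\<lambda>t. flow A (complex_of_real t) s) \<longlongrightarrow> 0) at_top}"
  note cu = unstable_center_subspace_props[where A = A]
  have "vec.subspace ?W"
    unfolding vec.subspace_def
  proof (intro conjI ballI allI)
    show "0 \<in> ?W" using vec.subspace_0[OF cu(1)] by (auto intro!: exI[of _ 0])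
  next
    fix x y assume "x \<in> ?W" "y \<in> ?W"
    then obtain s c s' c' where "x = s + c" "c \<in> unstable_center_subspace A"
      "((\<lambda>t. flow A (complex_of_real t) s) \<longlongrightarrow> 0) at_top"
      "y = s' + c'" "c' \<in> unstable_center_subspace A"
      "((\<lambda>t. flow A (complex_of_real t) s') \<longlongrightarrow> 0) at_top" by blast
    then show "x + y \<in> ?W"
      using tendsto_add[of "\<lambda>t. flow A (complex_of_real t) s" 0 at_top "\<lambda>t. flow A (complex_of_real t) s'" 0]
      by (intro CollectI exI[of _ "c + c'", THEN exI[of _ "s + s'"]])
        (auto simp: flow_add vec.subspace_add[OF cu(1)])
  next
    fix a x assume "x \<in> ?W"
    then obtain s c where s: "x = s + c" "c \<in> unstable_center_subspace A"
      "((\<lambda>t. flow A (complex_of_real t) s) \<longlongrightarrow> 0) at_top" by blast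
    have "((\<lambda>t. a *s flow A (complex_of_real t) s) \<longlongrightarrow> 0) at_top"
    proof (rule vec_tendstoI)
      fix i
      show "((\<lambda>t. (a *s flow A (complex_of_real t) s) $ i) \<longlongrightarrow> 0 $ i) at_top"
        using tendsto_mult_right_zero[OF tendsto_vec_nth[OF s(3), of i, simplified], of a] by simp
    qed
    then show "a *s x \<in> ?W"
      using s by (intro CollectI exI[of _ "a *s c", THEN exI[of _ "a *s s"]])
        (auto simp: flow_scale vec.scale_right_distrib vec.subspace_scale[OF cu(1)])
  qed
  moreover have "generalized_eigenspace A l \<subseteq> ?W" if "l \<in> eigenvalues A" for l
  proof (cases "Re l \<ge> 0")
    case True
    then show ?thesis using cu(3)[OF that] by (force intro: exI[of _ 0])
  next
    case False
    show ?thesis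
    proof
      fix x assume "x \<in> generalized_eigenspace A l"
      then have "((\<lambda>t. flow A (complex_of_real t) x) \<longlongrightarrow> 0) at_top"
        using False by (intro flow_tendsto_0[of A l]) (auto simp: generalized_eigenspace_def)
      then show "x \<in> ?W" using vec.subspace_0[OF cu(1)] by (intro CollectI exI[of _ 0, THEN exI[of _ x]]) auto
    qed
  qed
  ultimately have "?W = UNIV" by (rule generalized_eigenspaces_span)
  then show thesis using that by blast
qed

lemma norm_vector_scale: "norm (c *s x) = norm c * norm x" for c :: complex and x :: "complex ^ 'n"
  by (simp add: norm_vec_def norm_mult L2_set_right_distrib)

text \<open>Uniformity over a bounded set follows by decomposing the finitely many standard basis vectors.\<close>

lemma flow_attracted_to_unstable_center:
  fixes A :: "complex ^ 'n ^ 'n"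
  assumes K: "bounded K" and \<delta>: "\<delta> > 0"
  shows "\<forall>\<^sub>F t in at_top. \<forall>x\<in>K. \<exists>c\<in>unstable_center_subspace A.
           norm (flow A (complex_of_real t) x - c) < \<delta>"
proof -
  note cu = unstable_center_subspace_props[where A = A]
  obtain B where B: "B > 0" "\<And>x. x \<in> K \<Longrightarrow> norm x \<le> B"
    using K unfolding bounded_pos by auto
  have "\<forall>j :: 'n. \<exists>s c. axis j 1 = s + c \<and> c \<in> unstable_center_subspace A \<and>
      ((\<lambda>t. flow A (complex_of_real t) s) \<longlongrightarrow> 0) at_top"
    using stable_plus_unstable_center[of _ A] by metis
  then obtain s c where sc: "\<And>j. axis j 1 = s j + c j" "\<And>j. c j \<in> unstable_center_subspace A"
      "\<And>j :: 'n. ((\<lambda>t. flow A (complex_of_real t) (s j)) \<longlongrightarrow> 0) at_top" by metis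
  have "((\<lambda>t. \<Sum>j\<in>UNIV. B * norm (flow A (complex_of_real t) (s j))) \<longlongrightarrow> 0) at_top"
    by (intro tendsto_null_sum tendsto_mult_right_zero tendsto_norm_zero sc)
  then have "\<forall>\<^sub>F t in at_top. (\<Sum>j\<in>UNIV. B * norm (flow A (complex_of_real t) (s j))) < \<delta>"
    using \<delta> by (rule order_tendstoD)
  then show ?thesis
  proof eventually_elim
    case (elim t)
    show ?case
    proof
      fix x assume x: "x \<in> K"
      let ?c = "\<Sum>j\<in>UNIV. x $ j *s flow A (complex_of_real t) (c j)"
      have "flow A (complex_of_real t) x - ?c = (\<Sum>j\<in>UNIV. x $ j *s flow A (complex_of_real t) (s j))"
        by (subst flow_expand) (simp add: sc(1) flow_add vec.scale_right_distrib sum.distrib)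
      also have "norm \<dots> \<le> (\<Sum>j\<in>UNIV. B * norm (flow A (complex_of_real t) (s j)))"
        by (intro order_trans[OF norm_sum] sum_mono)
           (auto simp: norm_vector_scale intro!: mult_right_mono
             order_trans[OF Finite_Cartesian_Product.norm_nth_le B(2)[OF x]])
      also have "\<dots> < \<delta>" by (rule elim)
      finally have "norm (flow A (complex_of_real t) x - ?c) < \<delta>" .
      moreover have "?c \<in> unstable_center_subspace A"
        by (intro vec.subspace_sum[OF cu(1)] vec.subspace_scale[OF cu(1)] flow_in_subspace[OF cu(1)] cu(2) sc(2))
      ultimately show "\<exists>c\<in>unstable_center_subspace A. norm (flow A (complex_of_real t) x - c) < \<delta>" by blast
    qed
  qed
qed

section \<open>Flow-invariant domains\<close>

text \<open>The open tube of radius \<open>\<delta>\<close> around \<open>W\<close> is convex, meets \<open>\<Omega>\<close> in \<open>0\<close> and misses the boundary of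
  \<open>\<Omega>\<close>, so it lies in \<open>\<Omega>\<close>.\<close>

lemma tube_around_subspace:
  fixes W :: "(complex ^ 'n) set"
  assumes W: "vec.subspace W" and 0: "0 \<in> \<Omega>" and dist: "dist_to_boundary W \<Omega> > 0"
  obtains \<delta> where "\<delta> > 0" "\<And>x y. x \<in> W \<Longrightarrow> norm (y - x) < \<delta> \<Longrightarrow> y \<in> \<Omega>"
proof -
  obtain \<delta> where \<delta>: "0 < ereal \<delta>" "ereal \<delta> < dist_to_boundary W \<Omega>"
    using ereal_dense2[OF dist] by blast
  have far: "\<delta> < norm (x - y)" if "x \<in> W" "y \<in> frontier \<Omega>" for x y
  proof -
    have "dist_to_boundary W \<Omega> \<le> ereal (norm (x - y))"
      unfolding dist_to_boundary_def by (rule INF_lower2[of "(x, y)"]) (use that in auto)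
    with \<delta>(2) have "ereal \<delta> < ereal (norm (x - y))" by (rule less_le_trans)
    then show ?thesis by simp
  qed
  define N where "N = (\<Union>x\<in>W. \<Union>y\<in>ball 0 \<delta>. {x + y})"
  have "connected N"
    unfolding N_def by (intro convex_connected convex_sums closed_vec_subspace(2)[OF W] convex_ball)
  moreover have "0 \<in> N \<inter> \<Omega>"
    using 0 \<delta>(1) vec.subspace_0[OF W] by (force simp: N_def)
  moreover have "N \<inter> frontier \<Omega> = {}"
  proof -
    have False if "x \<in> W" "norm y < \<delta>" "x + y \<in> frontier \<Omega>" for x y
      using far[OF that(1,3)] that(2) by simp
    then show ?thesis by (auto simp: N_def)
  qed
  ultimately have "N - \<Omega> = {}" using connected_Int_frontier by blast
  moreover have "y \<in> N" if "x \<in> W" "norm (y - x) < \<delta>" for x y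
    using that unfolding N_def by (intro UN_I[of x] UN_I[of "y - x"]) auto
  ultimately show thesis using that[of \<delta>] \<delta>(1) by auto
qed

theorem corollary1p3:
  fixes A :: "complex ^ 'n ^ 'n" and \<Omega> :: "(complex ^ 'n) set"
  assumes "invertible A"
    and "domain_in_Cn \<Omega>"
    and "positive_time_flow_invariant A \<Omega>"
    and "0 \<in> \<Omega>"
    and "center_subspace A \<subseteq> \<Omega>"
    and "dist_to_boundary (unstable_center_subspace A) \<Omega> > 0"
  shows "runge_domain \<Omega>"
proof -
  let ?W = "unstable_center_subspace A"
  have W: "vec.subspace ?W" by (rule unstable_center_subspace_props)
  have \<Omega>: "open \<Omega>" using assms(2) by (simp add: domain_in_Cn_def)
  have inv: "flow A (complex_of_real t) z \<in> \<Omega>" if t: "t \<ge> 0" and z: "z \<in> \<Omega>" for t z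
    using assms(3) t z unfolding positive_time_flow_invariant_def by (auto simp: matrix_exp_eq_flow)
  obtain \<delta> where \<delta>: "\<delta> > 0" and tube: "\<And>x y. x \<in> ?W \<Longrightarrow> norm (y - x) < \<delta> \<Longrightarrow> y \<in> \<Omega>"
    using tube_around_subspace[OF W assms(4,6)] by blast
  have "poly_approx K f" if f: "holomorphic_Cn f \<Omega>" and K: "compact K" "K \<subseteq> \<Omega>" for f K
  proof -
    obtain T0 where T0: "\<And>t x. t \<ge> T0 \<Longrightarrow> x \<in> K \<Longrightarrow> \<exists>c\<in>?W. norm (flow A (complex_of_real t) x - c) < \<delta>"
      using flow_attracted_to_unstable_center[OF compact_imp_bounded[OF K(1)] \<delta>, of A]
      unfolding eventually_at_top_linorder by blast
    define T where "T = max T0 0"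
    \<comment> \<open>For large \<open>t\<close> the flow carries \<open>K\<close> into the tube, which is star-shaped about \<open>0\<close>.\<close>
    have late: "poly_approx K (\<lambda>z. f (flow A (complex_of_real t) z))" if t: "t \<ge> T" for t
    proof -
      define B where "B = (\<chi> i j. flow A (complex_of_real t) (axis j 1) $ i)"
      have B: "B *v z = flow A (complex_of_real t) z" for z
        unfolding B_def by (rule flow_eq_matrix[symmetric])
      have "complex_of_real s *s (B *v z) \<in> \<Omega>" if s: "0 \<le> s" "s \<le> 1" and z: "z \<in> K" for s z
      proof -
        obtain c where c: "c \<in> ?W" "norm (flow A (complex_of_real t) z - c) < \<delta>"
          using T0[of t z] t z by (auto simp: T_def)
        have "norm (complex_of_real s *s (B *v z) - complex_of_real s *s c) = s * norm (B *v z - c)"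
          unfolding vec.scale_right_diff_distrib[symmetric] norm_vector_scale using s(1) by simp
        also have "\<dots> \<le> norm (B *v z - c)"
          using s by (simp add: mult_left_le_one_le)
        also have "\<dots> < \<delta>" using c(2) by (simp only: B)
        finally show ?thesis
          by (rule tube[OF vec.subspace_scale[OF W c(1)]])
      qed
      then have "poly_approx K (\<lambda>z. f (B *v z))"
        by (rule poly_approx_starlike[OF \<Omega> assms(4) f K(1)])
      then show ?thesis by (simp only: B)
    qed
    have T: "0 \<le> T" by (simp add: T_def)
    \<comment> \<open>Continuation in \<open>t\<close> from \<open>T\<close> down to \<open>0\<close>; the points \<open>t > T\<close> accumulate at \<open>T\<close>.\<close>
    have "poly_approx K (\<lambda>z. f (flow A 0 z))"
    proof (rule poly_approx_along_path[OF \<Omega> f K(1), where \<Psi> = "flow A" and t = 0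
          and C = "complex_of_real ` {0..T}" and ?t0.0 = "complex_of_real T"])
      show "compact (complex_of_real ` {0..T})"
        by (intro compact_continuous_image continuous_intros) auto
      show "convex (complex_of_real ` {0..T})"
        by (intro convex_linear_image) (auto simp: linear_of_real)
      show "continuous_on UNIV (\<lambda>(t, z). flow A t z)" by (rule continuous_on_flow)
      show "(\<lambda>t. flow A t z $ i) field_differentiable at t" for z i t
        using has_field_derivative_flow unfolding field_differentiable_def by blast
      show "flow A t z \<in> \<Omega>" if "t \<in> complex_of_real ` {0..T}" "z \<in> K" for t z
        using that K(2) inv by auto
      show "complex_of_real T islimpt {s. poly_approx K (\<lambda>z. f (flow A s z))}"
        unfolding islimpt_approachable
      proof (intro allI impI)
        fix e :: real assume "e > 0"
        then show "\<exists>s\<in>{s. poly_approx K (\<lambda>z. f (flow A s z))}.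
            s \<noteq> complex_of_real T \<and> dist s (complex_of_real T) < e"
          using late[of "T + e / 2"]
          by (intro bexI[of _ "complex_of_real (T + e / 2)"]) (auto simp: dist_norm)
      qed
    qed (use T in \<open>auto intro: rev_image_eqI\<close>)
    then show ?thesis by simp
  qed
  then show ?thesis
    using assms(2) unfolding runge_domain_def poly_approx_def by blast
qed

end
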